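(* Let $f$ be a homeomorphism of a compact metric space $X$ satisfying the closing property, let $V$ be a Banach space, and let $\mathcal{A}$ be a Hölder continuous $GL(V)$-valued cocycle over $f$. For $x\in X$ and $n\in\mathbb{Z}$ let $Q(x,n)=\|\mathcal{A}_x^n\|\cdot\|(\mathcal{A}_x^n)^{-1}\|$. Then: (i) $$\lim_{n\to\infty}\sup\{\|\mathcal{A}_x^n\|^{1/n}: x\in X\}=\limsup_{k\to\infty}\ \sup\{\|\mathcal{A}_p^k\|^{1/k}: p\in X,\ p=f^kp\}.$$ In particular, if for some numbers $C$ and $s$ we have $\|\mathcal{A}_p^k\|\le Ce^{sk}$ whenever $p=f^kp$ (with $p\in X$, $k\in\mathbb{N}$), then for each $\epsilon>0$ there exists a number $C_\epsilon$ such that $\|\mathcal{A}_x^n\|\le C_\epsilon e^{(s+\epsilon)n}$ for all $x\in X$ and $n\in\mathbb{N}$. (ii) $$\lim_{n\to\pm\infty}\sup\{Q(x,n)^{1/|n|}: x\in X\}=\limsup_{k\to\infty}\ \sup\{Q(p,k)^{1/k}: p\in X,\ p=f^kp\}$$ (both the limit as $n\to\infty$ and the limit as $n\to-\infty$ are equal to the right-hand side). In particular, if for some numbers $C$ and $s$ we have $Q(p,k)\le Ce^{sk}$ whenever $p=f^kp$ (with $p\in X$, $k\in\mathbb{N}$), then for each $\epsilon>0$ there exists a number $C'_\epsilon$ such that $Q(x,n)\le C'_\epsilon e^{(s+\epsilon)|n|}$ for all $x\in X$ and $n\in\mathbb{Z}$.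
   Context: $\mathbb{N}$ denotes the positive integers. In the limsup over $k$, values of $k$ for which there is no $p$ with $f^kp=p$ are disregarded. Closing property: a homeomorphism $f$ of a metric space $X$ satisfies the closing property if there exist constants $D,\gamma,\delta_0>0$ such that for any $x\in X$ and $k\in\mathbb{N}$ with $\mathrm{dist}(x,f^kx)<\delta_0$ there exists a point $p\in X$ with $f^kp=p$ such that $\mathrm{dist}(f^ix,f^ip)\le D\,\mathrm{dist}(x,f^kx)\,e^{-\gamma\min\{i,k-i\}}$ for every $i=0,\dots,k$. $GL(V)$ is the group of invertible bounded linear operators on the Banach space $V$, with the metric $d(A,B)=\|A-B\|+\|A^{-1}-B^{-1}\|$, where $\|\cdot\|$ is the operator norm. Cocycles: the $GL(V)$-valued cocycle over $f$ generated by a function $A:X\to GL(V)$ is given by $\mathcal{A}_x^0=\mathrm{Id}$, $\mathcal{A}_x^n=A(f^{n-1}x)\circ\cdots\circ A(x)$ and $\mathcal{A}_x^{-n}=(\mathcal{A}_{f^{-n}x}^n)^{-1}$ for $n\in\mathbb{N}$. It is Hölder continuous if for some $0<\alpha\le1$ there exists $M>0$ such that $d(A(x),A(y))\le M\,\mathrm{dist}(x,y)^\alpha$ for all sufficiently close $x,y\in X$. *)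

theory Defs
  imports "HOL-Analysis.Analysis"
begin

definition GL :: "('v::real_normed_vector \<Rightarrow>\<^sub>L 'v) set" where
  "GL = {T. \<exists>S. T o\<^sub>L S = id_blinfun \<and> S o\<^sub>L T = id_blinfun}"

definition GL_inv :: "('v::real_normed_vector \<Rightarrow>\<^sub>L 'v) \<Rightarrow> ('v \<Rightarrow>\<^sub>L 'v)" where
  "GL_inv T = (THE S. T o\<^sub>L S = id_blinfun \<and> S o\<^sub>L T = id_blinfun)"

definition GL_dist :: "('v::real_normed_vector \<Rightarrow>\<^sub>L 'v) \<Rightarrow> ('v \<Rightarrow>\<^sub>L 'v) \<Rightarrow> real" where
  "GL_dist S T = norm (S - T) + norm (GL_inv S - GL_inv T)"

definition closing_property :: "('a::metric_space \<Rightarrow> 'a) \<Rightarrow> bool" where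
  "closing_property f \<longleftrightarrow>
    (\<exists>D \<gamma> \<delta>\<^sub>0. D > 0 \<and> \<gamma> > 0 \<and> \<delta>\<^sub>0 > 0 \<and>
      (\<forall>x. \<forall>k\<ge>1. dist x ((f ^^ k) x) < \<delta>\<^sub>0 \<longrightarrow>
        (\<exists>p. (f ^^ k) p = p \<and>
          (\<forall>i\<le>k. dist ((f ^^ i) x) ((f ^^ i) p)
            \<le> D * dist x ((f ^^ k) x) * exp (- \<gamma> * real (min i (k - i)))))))"

text \<open>The metric on the target is \<^const>\<open>GL_dist\<close>, not the operator-norm distance, so
  the inverses are controlled as well.\<close>

definition holder_GL :: "('a::metric_space \<Rightarrow> ('v::real_normed_vector \<Rightarrow>\<^sub>L 'v)) \<Rightarrow> bool" where
  "holder_GL A \<longleftrightarrow>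
    (\<exists>\<alpha> M \<delta>. 0 < \<alpha> \<and> \<alpha> \<le> 1 \<and> M > 0 \<and> \<delta> > 0 \<and>
      (\<forall>x y. dist x y < \<delta> \<longrightarrow> GL_dist (A x) (A y) \<le> M * dist x y powr \<alpha>))"

primrec cocycle_nat ::
    "('a \<Rightarrow> 'a) \<Rightarrow> ('a \<Rightarrow> ('v::real_normed_vector \<Rightarrow>\<^sub>L 'v)) \<Rightarrow> 'a \<Rightarrow> nat \<Rightarrow> ('v \<Rightarrow>\<^sub>L 'v)" where
  "cocycle_nat f A x 0 = id_blinfun"
| "cocycle_nat f A x (Suc n) = A ((f ^^ n) x) o\<^sub>L cocycle_nat f A x n"

definition cocycle ::
    "('a \<Rightarrow> 'a) \<Rightarrow> ('a \<Rightarrow> ('v::real_normed_vector \<Rightarrow>\<^sub>L 'v)) \<Rightarrow> 'a \<Rightarrow> int \<Rightarrow> ('v \<Rightarrow>\<^sub>L 'v)" where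
  "cocycle f A x n =
    (if 0 \<le> n then cocycle_nat f A x (nat n)
     else GL_inv (cocycle_nat f A ((inv f ^^ nat (- n)) x) (nat (- n))))"

definition cocycle_Q ::
    "('a \<Rightarrow> 'a) \<Rightarrow> ('a \<Rightarrow> ('v::real_normed_vector \<Rightarrow>\<^sub>L 'v)) \<Rightarrow> 'a \<Rightarrow> int \<Rightarrow> real" where
  "cocycle_Q f A x n = norm (cocycle f A x n) * norm (GL_inv (cocycle f A x n))"

text \<open>For \<open>\<phi> :: 'a \<Rightarrow> nat \<Rightarrow> real\<close> this is the upper limit, as \<open>k\<close> tends to infinity, of the
  supremum of \<open>\<phi> p k\<close> over the points \<open>p\<close> with \<open>f\<^sup>k p = p\<close>. The filter
  ranges only over those \<open>k\<close> for which such a \<open>p\<close> exists. Suprema and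
  limits are taken in \<^typ>\<open>ereal\<close>, so they need no boundedness side conditions.\<close>

definition periodic_limsup :: "('a \<Rightarrow> 'a) \<Rightarrow> ('a \<Rightarrow> nat \<Rightarrow> real) \<Rightarrow> ereal" where
  "periodic_limsup f \<phi> =
    Limsup (inf sequentially (principal {k. \<exists>p. (f ^^ k) p = p}))
      (\<lambda>k. SUP p\<in>{p. (f ^^ k) p = p}. ereal (\<phi> p k))"

end

theory Submission
  imports Defs
begin

text \<open>
  Let \<open>\<mu>\<close> be the exponential growth rate of the supremum over \<open>x\<close> of the norm of the
  \<open>n\<close>-step cocycle; rescale \<open>A\<close> so that \<open>\<mu> = 0\<close>.  Then all segments of length \<open>n\<close> have norm
  at most \<open>C exp (e n)\<close> uniformly, so no measure, ergodic theorem or Lyapunov norm is needed.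
  Along one long orbit whose total norm does not decay, the covering argument of Pliss' lemma
  shows that most pairs of times bound a good segment: one whose norm dominates, up to
  \<open>exp (\<epsilon> \<cdot> (lost length))\<close> and a constant, the norms of all its subsegments.  Cover \<open>X\<close> by \<open>P\<close> sets
  of diameter less than the closing constant.  As good pairs have density close to one, some
  good pair \<open>(i + m, j - m)\<close> comes with \<open>i\<close> and \<open>j\<close> in the same set.  The periodic orbit
  closing the segment from \<open>i\<close> to \<open>j\<close> is exponentially close in \<open>m\<close> to the middle part; a telescoping
  sum shows that the cocycle over that part keeps half of its norm, and the two ends of length
  \<open>m\<close> cost only a constant factor.

  The quasiconformal distortion is the norm of the cocycle of conjugations
  \<open>X \<mapsto> S X S\<^sup>-\<^sup>1\<close> on the Banach space of operators, so it obeys the same theorem.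
\<close>

section \<open>Bounded invertible operators and cocycles\<close>

lemma blinfun_compose_assoc: "(R o\<^sub>L S) o\<^sub>L T = R o\<^sub>L (S o\<^sub>L T)"
  by (rule blinfun_eqI) simp

lemma blinfun_compose_id [simp]:
  "T o\<^sub>L id_blinfun = T" "id_blinfun o\<^sub>L T = T"
  by (rule blinfun_eqI, simp)+

interpretation blinfun_compose: bounded_bilinear "(o\<^sub>L)"
  by (rule bounded_bilinear_blinfun_compose)

lemma GL_inv_eq:
  assumes "T o\<^sub>L S = id_blinfun" "S o\<^sub>L T = id_blinfun"
  shows "GL_inv T = S"
  unfolding GL_inv_def
proof (rule the_equality)
  fix R assume R: "T o\<^sub>L R = id_blinfun \<and> R o\<^sub>L T = id_blinfun"
  have "R = (S o\<^sub>L T) o\<^sub>L R" by (simp add: assms)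
  also have "\<dots> = S o\<^sub>L (T o\<^sub>L R)" by (rule blinfun_compose_assoc)
  finally show "R = S" using R by simp
qed (use assms in simp)

lemma GL_inv_right: "T \<in> GL \<Longrightarrow> T o\<^sub>L GL_inv T = id_blinfun"
  and GL_inv_left: "T \<in> GL \<Longrightarrow> GL_inv T o\<^sub>L T = id_blinfun"
  using GL_inv_eq by (auto simp: GL_def)

lemma GL_inv_apply:
  assumes "T \<in> GL"
  shows "blinfun_apply T (blinfun_apply (GL_inv T) v) = v"
    and "blinfun_apply (GL_inv T) (blinfun_apply T v) = v"
  using GL_inv_right[OF assms] GL_inv_left[OF assms]
  by (metis blinfun_apply_blinfun_compose blinfun_apply_id_blinfun)+

lemma GL_id: "id_blinfun \<in> GL"
  by (auto simp: GL_def intro: exI[of _ id_blinfun])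

lemma GL_inv_id: "GL_inv id_blinfun = id_blinfun"
  by (rule GL_inv_eq) auto

lemma
  assumes "S \<in> GL" "T \<in> GL"
  shows GL_compose: "S o\<^sub>L T \<in> GL"
    and GL_inv_compose: "GL_inv (S o\<^sub>L T) = GL_inv T o\<^sub>L GL_inv S"
proof -
  have *: "(S o\<^sub>L T) o\<^sub>L (GL_inv T o\<^sub>L GL_inv S) = id_blinfun"
    "(GL_inv T o\<^sub>L GL_inv S) o\<^sub>L (S o\<^sub>L T) = id_blinfun"
    by (rule blinfun_eqI, simp add: GL_inv_apply assms)+
  show "S o\<^sub>L T \<in> GL" using * unfolding GL_def by blast
  show "GL_inv (S o\<^sub>L T) = GL_inv T o\<^sub>L GL_inv S" by (rule GL_inv_eq[OF *])
qed

lemma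
  assumes "T \<in> GL"
  shows GL_GL_inv: "GL_inv T \<in> GL" and GL_inv_GL_inv: "GL_inv (GL_inv T) = T"
  using GL_inv_right[OF assms] GL_inv_left[OF assms] GL_inv_eq by (auto simp: GL_def)

lemma norm_GL_pos:
  fixes T :: "'v::real_normed_vector \<Rightarrow>\<^sub>L 'v"
  assumes "T \<in> GL" "(v::'v) \<noteq> 0"
  shows "0 < norm T"
proof -
  have "T \<noteq> 0"
    using GL_inv_apply(2)[OF assms(1), of v] assms(2) by auto
  then show ?thesis by simp
qed

section \<open>Cocycle products along an orbit and their bounds\<close>

lemma cocycle_nat_add:
  "cocycle_nat f A x (m + n) = cocycle_nat f A ((f ^^ m) x) n o\<^sub>L cocycle_nat f A x m"
  by (induction n) (auto simp: funpow_add blinfun_compose_assoc add.commute)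

lemma cocycle_nat_GL: "\<forall>x. A x \<in> GL \<Longrightarrow> cocycle_nat f A x n \<in> GL"
  by (induction n) (auto simp: GL_id GL_compose)

lemma cocycle_nat_scaleR:
  "cocycle_nat f (\<lambda>x. c *\<^sub>R A x) x n = c ^ n *\<^sub>R cocycle_nat f A x n"
  by (induction n) (auto simp: blinfun_compose.scaleR_left blinfun_compose.scaleR_right)

lemma norm_cocycle_nat_le:
  assumes "\<And>x. norm (A x) \<le> K" "1 \<le> K"
  shows "norm (cocycle_nat f A x n) \<le> K ^ n"
proof (induction n)
  case 0
  show ?case using norm_blinfun_id_le by simp
next
  case (Suc n)
  have "norm (cocycle_nat f A x (Suc n)) \<le> norm (A ((f^^n) x)) * norm (cocycle_nat f A x n)"
    by (simp add: norm_blinfun_compose)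
  also have "\<dots> \<le> K * K ^ n" using assms Suc by (intro mult_mono) auto
  finally show ?case by simp
qed

lemma norm_GL_inv_cocycle_nat_le:
  assumes "\<forall>x. A x \<in> GL" "\<And>x. norm (GL_inv (A x)) \<le> K" "1 \<le> K"
  shows "norm (GL_inv (cocycle_nat f A x n)) \<le> K ^ n"
proof (induction n)
  case 0
  show ?case using norm_blinfun_id_le by (simp add: GL_inv_id)
next
  case (Suc n)
  have "norm (GL_inv (cocycle_nat f A x (Suc n)))
      \<le> norm (GL_inv (cocycle_nat f A x n)) * norm (GL_inv (A ((f^^n) x)))"
    by (simp add: GL_inv_compose assms(1) cocycle_nat_GL norm_blinfun_compose)
  also have "\<dots> \<le> K ^ n * K" using assms Suc by (intro mult_mono) auto
  finally show ?case by (simp add: mult.commute)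
qed

text \<open>Telescoping over the mixed products that follow \<open>q\<close> for \<open>j\<close>
  steps and \<open>y\<close> afterwards: neighbouring ones differ in the single factor at time
  \<open>j\<close>.\<close>

lemma cocycle_nat_diff:
  "cocycle_nat f A q n - cocycle_nat f A y n =
    (\<Sum>j<n. cocycle_nat f A ((f ^^ Suc j) y) (n - Suc j) o\<^sub>L
      (A ((f ^^ j) q) - A ((f ^^ j) y)) o\<^sub>L cocycle_nat f A q j)"
proof (induction n)
  case (Suc n)
  let ?W = "cocycle_nat f A"
  have "(\<Sum>j<n. ?W ((f ^^ Suc j) y) (Suc n - Suc j) o\<^sub>L (A ((f ^^ j) q) - A ((f ^^ j) y)) o\<^sub>L ?W q j)
    = (\<Sum>j<n. A ((f^^n) y) o\<^sub>L (?W ((f ^^ Suc j) y) (n - Suc j) o\<^sub>L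
        (A ((f ^^ j) q) - A ((f ^^ j) y)) o\<^sub>L ?W q j))"
  proof (rule sum.cong[OF refl])
    fix j assume "j \<in> {..<n}"
    then have j: "Suc n - Suc j = Suc (n - Suc j)" "(n - Suc j) + Suc j = n" by auto
    have "(f ^^ (n - Suc j)) ((f ^^ Suc j) y) = (f ^^ n) y"
      by (metis j(2) funpow_add comp_apply)
    then show "?W ((f ^^ Suc j) y) (Suc n - Suc j) o\<^sub>L (A ((f ^^ j) q) - A ((f ^^ j) y)) o\<^sub>L ?W q j
      = A ((f^^n) y) o\<^sub>L (?W ((f ^^ Suc j) y) (n - Suc j) o\<^sub>L
        (A ((f ^^ j) q) - A ((f ^^ j) y)) o\<^sub>L ?W q j)"
      unfolding j(1) cocycle_nat.simps by (simp add: blinfun_compose_assoc)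
  qed
  also have "\<dots> = A ((f^^n) y) o\<^sub>L (?W q n - ?W y n)"
    by (simp add: Suc.IH blinfun_compose.sum_right)
  finally show ?case
    by (simp add: blinfun_compose.diff_left blinfun_compose.diff_right algebra_simps)
qed simp

text \<open>The telescoping sum is bounded by strong induction on its length. In the first half of
  the segment the part along \<open>y\<close> is controlled by \<open>sub\<close> and the part along
  \<open>q\<close> by \<open>up\<close>; in the second half the part along \<open>y\<close> is
  controlled by \<open>up\<close> and the part along \<open>q\<close> by the induction hypothesis.
  Either way the rate \<open>4 * \<epsilon>\<close> in \<open>close\<close> leaves a geometric decay
  in the distance to the nearer end.\<close>

lemma closing_estimate:
  fixes A :: "'a \<Rightarrow> ('v::real_normed_vector \<Rightarrow>\<^sub>L 'v)"
    and f :: "'a \<Rightarrow> 'a" and y q :: 'a and w \<epsilon> C L \<kappa> :: real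
    and W :: "'a \<Rightarrow> nat \<Rightarrow> ('v \<Rightarrow>\<^sub>L 'v)" and n :: nat
  defines "W \<equiv> cocycle_nat f A"
  defines "w \<equiv> norm (W y n)"
  assumes "0 < \<epsilon>" "1 \<le> C" "1 \<le> L" "0 \<le> \<kappa>"
    and up: "\<And>z (j::nat). norm (W z j) \<le> C * exp (\<epsilon> * j)"
    and sub: "\<And>i j::nat. i + j \<le> n \<Longrightarrow> norm (W ((f ^^ i) y) j) \<le> L * exp (\<epsilon> * (real n - j)) * w"
    and close: "\<And>i. i < n \<Longrightarrow> norm (A ((f ^^ i) q) - A ((f ^^ i) y))
      \<le> \<kappa> * exp (- (4 * \<epsilon>) * min i (n - i))"
    and small: "8 * L * C * \<kappa> * exp \<epsilon> \<le> 1 - exp (- (2 * \<epsilon>))"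
  shows "norm (W q n) \<ge> w / 2"
proof -
  \<comment> \<open>What remains of the decay rate \<open>4 * \<epsilon>\<close> after two growth
    factors of rate \<open>\<epsilon>\<close>.\<close>
  define r where "r = exp (- (2 * \<epsilon>))"
  have r: "0 < r" "r < 1" using assms by (auto simp: r_def)
  have w0: "0 \<le> w" by (simp add: w_def)
  define H where "H = 2 * L * C * \<kappa> * exp \<epsilon> * w"
  have H0: "0 \<le> H" using assms(3-6) w0 by (simp add: H_def)
  have geo1: "(\<Sum>j<i. r ^ j) \<le> 1 / (1 - r)" for i
    using r by (simp add: sum_gp_strict divide_right_mono)
  have geo2: "(\<Sum>j<i. r ^ (n - j)) \<le> 1 / (1 - r)" if "i \<le> n" for i :: nat
  proof -
    have "(\<Sum>j<i. r ^ (n - j)) = (\<Sum>k\<in>(\<lambda>j. n - j) ` {..<i}. r ^ k)"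
      using that by (subst sum.reindex) (auto simp: inj_on_def)
    also have "\<dots> \<le> (\<Sum>k<Suc n. r ^ k)"
      using r by (intro sum_mono2) auto
    finally show ?thesis using geo1[of "Suc n"] by simp
  qed
  have summand: "norm (W ((f ^^ Suc j) y) (i - Suc j) o\<^sub>L
      (A ((f ^^ j) q) - A ((f ^^ j) y)) o\<^sub>L W q j)
      \<le> H * exp (\<epsilon> * (real n - i)) * (r ^ j + r ^ (n - j))"
    if IH: "\<And>j::nat. j < i \<Longrightarrow> norm (W q j) \<le> 2 * L * exp (\<epsilon> * (real n - j)) * w"
      and i: "i \<le> n" and j: "j < i" for i j :: nat
  proof -
    let ?U = "norm (W ((f ^^ Suc j) y) (i - Suc j))"
    let ?D = "norm (A ((f ^^ j) q) - A ((f ^^ j) y))"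
    have "norm (W ((f ^^ Suc j) y) (i - Suc j) o\<^sub>L
      (A ((f ^^ j) q) - A ((f ^^ j) y)) o\<^sub>L W q j) \<le> ?U * ?D * norm (W q j)"
      by (meson norm_blinfun_compose order_trans mult_right_mono norm_ge_zero)
    also have "\<dots> \<le> H * exp (\<epsilon> * (real n - i)) * r ^ min j (n - j)"
    proof (cases "2 * j \<le> n")
      case True
      then have mn: "min j (n - j) = j" by auto
      have "?U * ?D * norm (W q j) \<le> (L * exp (\<epsilon> * (real n - (i - Suc j))) * w) *
          (\<kappa> * exp (- (4 * \<epsilon>) * j)) * (C * exp (\<epsilon> * j))"
        using sub[of "Suc j" "i - Suc j"] close[of j] up[of q j] i j mn assms(3-6) w0
        by (intro mult_mono) auto
      also have "\<dots> = L * C * \<kappa> * w *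
          (exp (\<epsilon> * (real n - (i - Suc j))) * exp (- (4 * \<epsilon>) * j) * exp (\<epsilon> * j))"
        by (simp add: algebra_simps)
      also have "exp (\<epsilon> * (real n - (i - Suc j))) * exp (- (4 * \<epsilon>) * j) * exp (\<epsilon> * j)
          = exp \<epsilon> * exp (\<epsilon> * (real n - i)) * r ^ j"
        using j by (simp add: r_def exp_of_nat_mult[symmetric] exp_add[symmetric] of_nat_diff algebra_simps)
      also have "L * C * \<kappa> * w * (exp \<epsilon> * exp (\<epsilon> * (real n - i)) * r ^ j)
        \<le> 2 * L * C * \<kappa> * w * (exp \<epsilon> * exp (\<epsilon> * (real n - i)) * r ^ j)"
        using assms(3-6) w0 r by (intro mult_right_mono) auto
      finally show ?thesis by (simp add: H_def mn mult_ac)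
    next
      case False
      then have mn: "min j (n - j) = n - j" by auto
      have "?U * ?D * norm (W q j) \<le> (C * exp (\<epsilon> * (i - Suc j))) *
          (\<kappa> * exp (- (4 * \<epsilon>) * (n - j))) * (2 * L * exp (\<epsilon> * (real n - j)) * w)"
        using up[of "(f ^^ Suc j) y" "i - Suc j"] close[of j] IH[of j] i j mn assms(3-6) w0
        by (intro mult_mono) auto
      also have "\<dots> = 2 * L * C * \<kappa> * w *
          (exp (\<epsilon> * (i - Suc j)) * exp (- (4 * \<epsilon>) * (n - j)) * exp (\<epsilon> * (real n - j)))"
        by (simp add: algebra_simps)
      also have "\<dots> \<le> 2 * L * C * \<kappa> * w * (exp \<epsilon> * exp (\<epsilon> * (real n - i)) * r ^ (n - j))"
      proof (rule mult_left_mono)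
        have "\<epsilon> * i \<le> \<epsilon> * n" "0 \<le> \<epsilon>" using i assms(3) by auto
        then have "\<epsilon> * (i - Suc j) + - (4 * \<epsilon>) * (n - j) + \<epsilon> * (real n - j) \<le>
          \<epsilon> + \<epsilon> * (real n - i) + real (n - j) * - (2 * \<epsilon>)"
          using i j by (simp add: of_nat_diff algebra_simps)
        then show "exp (\<epsilon> * (i - Suc j)) * exp (- (4 * \<epsilon>) * (n - j)) * exp (\<epsilon> * (real n - j))
          \<le> exp \<epsilon> * exp (\<epsilon> * (real n - i)) * r ^ (n - j)"
          unfolding r_def exp_of_nat_mult[symmetric] exp_add[symmetric] exp_le_cancel_iff .
      qed (use assms(3-6) w0 in auto)
      finally show ?thesis by (simp add: H_def mn mult_ac)
    qed
    also have "\<dots> \<le> H * exp (\<epsilon> * (real n - i)) * (r ^ j + r ^ (n - j))"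
      using H0 r by (intro mult_left_mono) (auto simp: min_def)
    finally show ?thesis .
  qed
  have step: "norm (W q i - W y i) \<le> w / 2 * exp (\<epsilon> * (real n - i))"
    if IH: "\<And>j::nat. j < i \<Longrightarrow> norm (W q j) \<le> 2 * L * exp (\<epsilon> * (real n - j)) * w"
      and i: "i \<le> n" for i :: nat
  proof -
    have "norm (W q i - W y i) \<le> (\<Sum>j<i. H * exp (\<epsilon> * (real n - i)) * (r ^ j + r ^ (n - j)))"
      unfolding W_def cocycle_nat_diff using summand[OF IH i]
      by (intro sum_norm_le) (auto simp: W_def)
    also have "\<dots> = H * exp (\<epsilon> * (real n - i)) * ((\<Sum>j<i. r ^ j) + (\<Sum>j<i. r ^ (n - j)))"
      by (simp only: sum_distrib_left[symmetric] sum.distrib)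
    also have "\<dots> \<le> H * exp (\<epsilon> * (real n - i)) * (2 / (1 - r))"
      using geo1[of i] geo2[OF i] H0 by (intro mult_left_mono) auto
    also have "\<dots> = (H * 2 / (1 - r)) * exp (\<epsilon> * (real n - i))" by simp
    \<comment> \<open>The constant 8 of \<open>small\<close> is spent here: one factor 2 sits in
      \<open>H\<close>, one comes from the two geometric sums, one yields
      \<open>w / 2\<close>.\<close>
    also have "H * 2 / (1 - r) \<le> w / 2"
    proof -
      have "8 * L * C * \<kappa> * exp \<epsilon> * w \<le> (1 - r) * w"
        using small w0 unfolding r_def by (rule mult_right_mono)
      then show ?thesis using r by (simp add: H_def field_simps)
    qed
    finally show ?thesis by simp
  qed
  \<comment> \<open>The induction closes because \<open>step\<close> uses this bound at earlier
    times only; its error term is at most the bound for \<open>y\<close> itself, which explains the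
    factor 2.\<close>
  have bound: "norm (W q i) \<le> 2 * L * exp (\<epsilon> * (real n - i)) * w" if "i \<le> n" for i :: nat
    using that
  proof (induction i rule: less_induct)
    case (less i)
    have "norm (W q i) \<le> norm (W y i) + norm (W q i - W y i)"
      by (simp add: norm_triangle_sub)
    also have "norm (W y i) \<le> L * exp (\<epsilon> * (real n - i)) * w"
      using sub[of 0 i] less.prems by simp
    also have "norm (W q i - W y i) \<le> w / 2 * exp (\<epsilon> * (real n - i))"
      using less by (intro step) auto
    also have "w / 2 * exp (\<epsilon> * (real n - i)) \<le> L * exp (\<epsilon> * (real n - i)) * w"
    proof -
      have "w / 2 \<le> L * w" using w0 assms(5) mult_right_mono[of 1 L w] by linarith
      then show ?thesis using mult_right_mono[of "w/2" "L*w" "exp (\<epsilon> * (real n - i))"]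
        by (simp add: mult_ac)
    qed
    finally show ?case by (simp add: mult_ac)
  qed
  have "norm (W q n - W y n) \<le> w / 2"
    using step[of n] bound by simp
  then show ?thesis
    using norm_triangle_ineq2[of "W y n" "W q n"] by (simp add: w_def norm_minus_commute)
qed

section \<open>Good pairs of times along an orbit\<close>

text \<open>Disjoint intervals over each of which \<open>h\<close> drops by more than \<open>c\<close> cover the bad times; each
  drop pays for the constant \<open>c\<close> in the growth bound over the gap next to it.\<close>

lemma pliss:
  fixes h :: "nat \<Rightarrow> real" and u v :: nat and \<theta> c :: real
  assumes incr: "\<And>t t'. u \<le> t \<Longrightarrow> t \<le> t' \<Longrightarrow> t' \<le> v \<Longrightarrow> h t' \<le> h t + \<theta> * (t' - t) + c"
    and "0 \<le> \<theta>" "u \<le> v"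
  shows "\<theta> * card {t\<in>{u<..v}. \<exists>t'\<in>{u..<t}. h t + c < h t'} \<le> \<theta> * (v - u) + c + h u - h v"
proof -
  define B where "B w = {t\<in>{u<..w}. \<exists>t'\<in>{u..<t}. h t + c < h t'}" for w
  have fin: "finite (B w)" for w by (simp add: B_def)
  \<comment> \<open>Generalised to every end \<open>w\<close>: the slope is charged to the times
    that are not bad.\<close>
  have "h w \<le> h u + \<theta> * (real w - u - card (B w)) + c" if "u \<le> w" "w \<le> v" for w
    using that
  proof (induction w rule: less_induct)
    case (less w)
    show ?case
    proof (cases "B w = {}")
      case True
      then show ?thesis using incr[of u w] less.prems by (simp add: of_nat_diff)
    next
      case False
      \<comment> \<open>Jump back from the last bad time \<open>t\<close> to its witness
        \<open>t'\<close>. The drop of \<open>h\<close> in between pays for the constant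
        \<open>c\<close> incurred after \<open>t\<close>, and all bad times beyond \<open>t'\<close>
        lie in the interval jumped over.\<close>
      define t where "t = Max (B w)"
      have t: "t \<in> B w" using False fin by (simp add: t_def)
      then obtain t' where t': "u \<le> t'" "t' < t" "h t + c < h t'" and tw: "u < t" "t \<le> w"
        by (auto simp: B_def)
      have "B w \<subseteq> B t' \<union> {t'<..t}"
      proof
        fix z assume z: "z \<in> B w"
        then have "z \<le> t" using fin by (simp add: t_def)
        then show "z \<in> B t' \<union> {t'<..t}" using z by (auto simp: B_def)
      qed
      then have "card (B w) \<le> card (B t' \<union> {t'<..t})" by (intro card_mono) (auto simp: fin)
      also have "\<dots> \<le> card (B t') + (t - t')" using card_Un_le[of "B t'" "{t'<..t}"] by simp
      finally have card: "real (card (B w)) \<le> card (B t') + (real t - t')" using t' by linarith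
      have "h w \<le> h t + \<theta> * (w - t) + c" using incr[of t w] tw less.prems t' by simp
      also have "\<dots> \<le> h t' + \<theta> * (w - t)" using t' by simp
      also have "h t' \<le> h u + \<theta> * (real t' - u - card (B t')) + c"
        using t' tw less by auto
      finally have "h w \<le> h u + \<theta> * (real t' - u - card (B t') + (real w - t)) + c"
        using tw by (simp add: of_nat_diff algebra_simps)
      also have "\<dots> \<le> h u + \<theta> * (real w - u - card (B w)) + c"
        using card assms(2) by (intro add_mono mult_left_mono) auto
      finally show ?thesis .
    qed
  qed
  from this[of v] show ?thesis using assms(3) unfolding B_def
    by (simp add: of_nat_diff algebra_simps)
qed

text \<open>This is \<open>pliss\<close> with slope \<open>e + \<epsilon>\<close>. The part
  \<open>\<epsilon>\<close> of the slope cancels against the term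
  \<open>\<epsilon> * (N - s)\<close> in \<open>F s N\<close>, and \<open>low\<close> with
  subadditivity bounds what is left by \<open>2 * e * N + 2 * c\<close>.\<close>

lemma card_bad_ends:
  fixes b :: "nat \<Rightarrow> nat \<Rightarrow> real" and N :: nat and e c \<epsilon> :: real
  assumes sub: "\<And>s t u. s \<le> t \<Longrightarrow> t \<le> u \<Longrightarrow> u \<le> N \<Longrightarrow> b s u \<le> b s t + b t u"
    and refl: "\<And>t. b t t = 0"
    and up: "\<And>s t. s \<le> t \<Longrightarrow> t \<le> N \<Longrightarrow> b s t \<le> e * (real t - s) + c"
    and low: "- (e * N) \<le> b 0 N"
    and "0 \<le> e" "0 < \<epsilon>" "0 \<le> c" "s \<le> N"
  defines "F \<equiv> \<lambda>s t. b s t + \<epsilon> * (real t - s)"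
  shows "\<epsilon> * card {t\<in>{s<..N}. \<exists>t'\<in>{s..<t}. F s t + c < F s t'} \<le> 2 * e * N + 2 * c"
proof -
  let ?n = "real (card {t\<in>{s<..N}. \<exists>t'\<in>{s..<t}. F s t + c < F s t'})"
  have "(e + \<epsilon>) * ?n \<le> (e + \<epsilon>) * (N - s) + c + F s s - F s N"
  proof (rule pliss)
    fix t t' assume "s \<le> t" "t \<le> t'" "t' \<le> N"
    then show "F s t' \<le> F s t + (e + \<epsilon>) * (t' - t) + c"
      using sub[of s t t'] up[of t t'] by (simp add: F_def of_nat_diff algebra_simps)
  qed (use assms in auto)
  moreover have "F s s = 0" by (simp add: F_def refl)
  moreover have "b 0 N \<le> b 0 s + b s N" "b 0 s \<le> e * s + c"
    using sub[of 0 s N] up[of 0 s] assms by auto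
  moreover have "\<epsilon> * ?n \<le> (e + \<epsilon>) * ?n" using assms by (simp add: distrib_right)
  ultimately show ?thesis using low assms(8) by (simp add: F_def of_nat_diff algebra_simps)
qed

text \<open>This is \<open>pliss\<close> in reversed time. The score of a start \<open>s\<close> is
  the best value over all ends up to \<open>t\<close>, so that a good start and a good end together
  beat every subsegment.\<close>

lemma card_bad_starts:
  fixes b :: "nat \<Rightarrow> nat \<Rightarrow> real" and N :: nat and e c \<epsilon> :: real
  assumes sub: "\<And>s t u. s \<le> t \<Longrightarrow> t \<le> u \<Longrightarrow> u \<le> N \<Longrightarrow> b s u \<le> b s t + b t u"
    and refl: "\<And>t. b t t = 0"
    and up: "\<And>s t. s \<le> t \<Longrightarrow> t \<le> N \<Longrightarrow> b s t \<le> e * (real t - s) + c"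
    and low: "- (e * N) \<le> b 0 N"
    and "0 \<le> e" "0 < \<epsilon>" "0 \<le> c" "t \<le> N"
  defines "G \<equiv> \<lambda>s t. Max ((\<lambda>t'. b s t' + \<epsilon> * (real t' - s)) ` {s..t})"
  shows "\<epsilon> * card {s\<in>{..<t}. \<exists>s'\<in>{s<..t}. G s t + c < G s' t} \<le> 2 * e * N + 2 * c"
proof -
  have G_ge: "b s t' + \<epsilon> * (real t' - s) \<le> G s t" if "s \<le> t'" "t' \<le> t" for s t' t
    unfolding G_def using that by (intro Max_ge) auto
  have G_le: "G s t \<le> z"
    if "s \<le> t" "\<And>t'. s \<le> t' \<Longrightarrow> t' \<le> t \<Longrightarrow> b s t' + \<epsilon> * (real t' - s) \<le> z" for s t z
    unfolding G_def using that by (subst Max_le_iff) auto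
  define h where "h r = G (t - r) t" for r
  let ?S = "{s\<in>{..<t}. \<exists>s'\<in>{s<..t}. G s t + c < G s' t}"
  let ?R = "{r\<in>{0<..t}. \<exists>r'\<in>{0..<r}. h r + c < h r'}"
  have "?S \<subseteq> (\<lambda>r. t - r) ` ?R"
  proof
    fix s assume "s \<in> ?S"
    then obtain s' where s: "s < s'" "s' \<le> t" "G s t + c < G s' t" by auto
    then show "s \<in> (\<lambda>r. t - r) ` ?R"
      by (intro image_eqI[of _ _ "t - s"]) (auto simp: h_def intro!: bexI[of _ "t - s'"])
  qed
  then have "card ?S \<le> card ?R"
    by (rule surj_card_le[rotated]) simp
  have "(e + \<epsilon>) * real (card ?R) \<le> (e + \<epsilon>) * (t - 0) + c + h 0 - h t"
  proof (rule pliss)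
    fix r r' assume r: "0 \<le> r" "r \<le> r'" "r' \<le> t"
    let ?s = "t - r" and ?q = "t - r'"
    have "b ?q t' + \<epsilon> * (real t' - ?q) \<le> G ?s t + (e + \<epsilon>) * (r' - r) + c"
      if t': "?q \<le> t'" "t' \<le> t" for t'
    proof (cases "?s \<le> t'")
      case True
      have "?q \<le> ?s" using r by simp
      with True show ?thesis
        using sub[of ?q ?s t'] up[of ?q ?s] G_ge[of ?s t' t] r t' \<open>t \<le> N\<close>
        by (simp add: of_nat_diff algebra_simps)
    next
      case False
      \<comment> \<open>The segment ends before the old start \<open>?s\<close>, so it is compared
        with the empty segment at \<open>?s\<close>, of value 0.\<close>
      have "0 \<le> G ?s t" using G_ge[of ?s ?s t] refl by simp
      moreover have "real t' - ?q \<le> real (r' - r)" using False r by (simp add: of_nat_diff)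
      then have "(e + \<epsilon>) * (real t' - ?q) \<le> (e + \<epsilon>) * real (r' - r)"
        using assms by (intro mult_left_mono) auto
      moreover have "b ?q t' \<le> e * (real t' - ?q) + c" using up[of ?q t'] t' \<open>t \<le> N\<close> by simp
      ultimately show ?thesis by (simp add: algebra_simps)
    qed
    then show "h r' \<le> h r + (e + \<epsilon>) * (r' - r) + c"
      unfolding h_def by (intro G_le) auto
  qed (use assms in auto)
  moreover have "h 0 = 0" by (simp add: h_def G_def refl)
  moreover have "b 0 t + \<epsilon> * t \<le> h t" using G_ge[of 0 t t] by (simp add: h_def)
  moreover have "b 0 N \<le> b 0 t + b t N" "b t N \<le> e * (real N - t) + c"
    using sub[of 0 t N] up[of t N] assms by auto
  moreover have "\<epsilon> * card ?R \<le> (e + \<epsilon>) * card ?R" using assms by (simp add: distrib_right)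
  moreover have "\<epsilon> * card ?S \<le> \<epsilon> * card ?R" using \<open>card ?S \<le> card ?R\<close> assms by simp
  ultimately show ?thesis using low assms(8) by (simp add: algebra_simps)
qed

section \<open>Double counting of pairs of times with equal colour\<close>

lemma popular_value:
  assumes "finite J" "\<And>i. i \<in> J \<Longrightarrow> col i < (P::nat)" "J \<noteq> {}"
  obtains d where "d < P" "card J \<le> P * card {i\<in>J. col i = d}"
proof -
  have "\<exists>d<P. card J \<le> P * card {i\<in>J. col i = d}"
  proof (rule ccontr)
    assume "\<not> ?thesis"
    then have less: "\<And>d. d < P \<Longrightarrow> P * card {i\<in>J. col i = d} < card J" by force
    have "J = (\<Union>d<P. {i\<in>J. col i = d})" using assms by auto
    then have "card J \<le> (\<Sum>d<P. card {i\<in>J. col i = d})"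
      by (metis card_UN_le finite_lessThan)
    then have "P * card J \<le> (\<Sum>d<P. P * card {i\<in>J. col i = d})"
      by (metis mult_le_mono2 sum_distrib_left)
    also have "\<dots> < (\<Sum>d<P. card J)"
      using assms less by (intro sum_strict_mono) auto
    finally show False by simp
  qed
  then show thesis using that by blast
qed

text \<open>Among \<open>P + 1\<close> separated blocks of length \<open>B\<close>, two share a
  colour that fills at least the fraction \<open>1 / P\<close> of each. This gives at least
  \<open>B\<^sup>2 / P\<^sup>2\<close> pairs of equal colour, of which at most
  \<open>2 * B * \<beta>\<close> are bad.\<close>

lemma same_colour_good_pair:
  fixes P B m :: nat and \<beta> :: real
  assumes col: "\<And>i. col i < P"
    and B: "2 * m \<le> B" "2 * P\<^sup>2 * \<beta> < B"
    and N: "N = (2 * P + 1) * B"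
    and bad1: "\<And>s. s \<le> N \<Longrightarrow> card {t\<in>{s<..N}. bad1 s t} \<le> \<beta>"
    and bad2: "\<And>t. t \<le> N \<Longrightarrow> card {s\<in>{..<t}. bad2 s t} \<le> \<beta>"
  obtains i j where "i + B < j" "j \<le> N" "col i = col j"
    "\<not> bad1 (i + m) (j - m)" "\<not> bad2 (i + m) (j - m)"
proof -
  have "0 \<le> \<beta>" using bad1[of 0] by (smt (verit) of_nat_0_le_iff zero_le)
  then have B0: "0 < B" using B(2) by (smt (verit) of_nat_0_less_iff zero_le_mult_iff of_nat_0_le_iff zero_le_power2)
  \<comment> \<open>Only every second block of length \<open>B\<close> is used, which keeps times
    from different blocks more than \<open>B\<close> apart.\<close>
  define J where "J a = {2 * a * B..<(2 * a + 1) * B}" for a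
  have J: "finite (J a)" "card (J a) = B" "J a \<noteq> {}" for a
    using B0 by (auto simp: J_def)
  have "\<exists>d<P. B \<le> P * card {i\<in>J a. col i = d}" for a
    using popular_value[of "J a" col P] J col by metis
  then obtain d where d: "\<And>a. d a < P" "\<And>a. B \<le> P * card {i\<in>J a. col i = d a}" by metis
  have "\<not> inj_on d {..P}"
  proof
    assume "inj_on d {..P}"
    then have "card {..P} \<le> card {..<P}" by (rule card_inj_on_le) (use d in auto)
    then show False by simp
  qed
  then obtain a a' where "a \<le> P" "a' \<le> P" "d a = d a'" "a \<noteq> a'"
    by (auto simp: inj_on_def)
  then obtain a a' where aa: "a < a'" "a' \<le> P" "d a = d a'" by (metis nat_neq_iff)
  define I where "I = {i\<in>J a. col i = d a}"
  define I' where "I' = {i\<in>J a'. col i = d a}"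
  have fin: "finite I" "finite I'" and sub: "I \<subseteq> J a" "I' \<subseteq> J a'"
    using J by (auto simp: I_def I'_def)
  have cI: "B \<le> P * card I" "B \<le> P * card I'" using d(2)[of a] d(2)[of a'] aa by (auto simp: I_def I'_def)
  have cB: "card I \<le> B" "card I' \<le> B" using card_mono[OF _ sub(1)] card_mono[OF _ sub(2)] J by auto
  have far: "i + B < j" "j < N" if "i \<in> I" "j \<in> I'" for i j
  proof -
    have "(2 * a + 1) * B + B \<le> 2 * a' * B"
      using mult_le_mono1[of "2 * a + 2" "2 * a'" B] aa by (simp add: algebra_simps)
    moreover have "(2 * a' + 1) * B \<le> N" unfolding N using aa by (intro mult_le_mono1) auto
    moreover have "i < (2 * a + 1) * B" "2 * a' * B \<le> j" "j < (2 * a' + 1) * B"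
      using that sub by (auto simp: J_def)
    ultimately show "i + B < j" "j < N" by linarith+
  qed
  have "\<exists>i\<in>I. \<exists>j\<in>I'. \<not> bad1 (i + m) (j - m) \<and> \<not> bad2 (i + m) (j - m)"
  proof (rule ccontr)
    assume "\<not> ?thesis"
    then have bad: "I \<times> I' \<subseteq> Sigma I (\<lambda>i. {j\<in>I'. bad1 (i + m) (j - m)}) \<union>
        prod.swap ` Sigma I' (\<lambda>j. {i\<in>I. bad2 (i + m) (j - m)})" (is "_ \<subseteq> ?X \<union> prod.swap ` ?Y")
      by fastforce
    have "card {j\<in>I'. bad1 (i + m) (j - m)} \<le> card {t\<in>{i + m<..N}. bad1 (i + m) t}" if "i \<in> I" for i
    proof (rule card_inj_on_le[where f = "\<lambda>j. j - m"])
      \<comment> \<open>Elements of \<open>I'\<close> exceed \<open>B\<close>, hence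
        \<open>m\<close>, so the truncated subtraction loses nothing.\<close>
      show "inj_on (\<lambda>j. j - m) {j\<in>I'. bad1 (i + m) (j - m)}"
        using far[OF that] B by (intro inj_on_diff_nat) fastforce
      show "(\<lambda>j. j - m) ` {j\<in>I'. bad1 (i + m) (j - m)} \<subseteq> {t\<in>{i + m<..N}. bad1 (i + m) t}"
        using far[OF that] B by fastforce
    qed simp
    moreover have "i + m \<le> N" if "i \<in> I" for i
    proof -
      obtain j where "j \<in> I'" using cI B0 by (metis card.empty ex_in_conv mult_0_right not_le)
      then show ?thesis using far[OF that] B by fastforce
    qed
    ultimately have c1: "card {j\<in>I'. bad1 (i + m) (j - m)} \<le> \<beta>" if "i \<in> I" for i
      using that bad1 by (meson of_nat_le_iff order_trans)
    have "card {i\<in>I. bad2 (i + m) (j - m)} \<le> card {s\<in>{..<j - m}. bad2 s (j - m)}" if "j \<in> I'" for j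
    proof (rule card_inj_on_le[where f = "\<lambda>i. i + m"])
      show "(\<lambda>i. i + m) ` {i\<in>I. bad2 (i + m) (j - m)} \<subseteq> {s\<in>{..<j - m}. bad2 s (j - m)}"
        using far[OF _ that] B by fastforce
    qed auto
    moreover have "j - m \<le> N" if "j \<in> I'" for j
      using that sub J aa far
    proof -
      obtain i where "i \<in> I" using cI B0 by (metis card.empty ex_in_conv mult_0_right not_le)
      then show ?thesis using far[of i j] that by linarith
    qed
    ultimately have c2: "card {i\<in>I. bad2 (i + m) (j - m)} \<le> \<beta>" if "j \<in> I'" for j
      using that bad2 by (meson of_nat_le_iff order_trans)
    have "real (card I * card I') \<le> real (card ?X + card ?Y)"
    proof -
      have "card (I \<times> I') \<le> card (?X \<union> prod.swap ` ?Y)"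
        using bad fin by (intro card_mono) auto
      also have "\<dots> \<le> card ?X + card ?Y"
        using card_Un_le[of ?X "prod.swap ` ?Y"] card_image_le[of ?Y prod.swap] fin by fastforce
      finally show ?thesis by (simp only: of_nat_le_iff card_cartesian_product)
    qed
    also have "\<dots> = (\<Sum>i\<in>I. real (card {j\<in>I'. bad1 (i + m) (j - m)})) +
        (\<Sum>j\<in>I'. real (card {i\<in>I. bad2 (i + m) (j - m)}))"
      using fin by simp
    also have "\<dots> \<le> card I * \<beta> + card I' * \<beta>"
      by (intro add_mono sum_bounded_above c1 c2)
    also have "\<dots> \<le> 2 * B * \<beta>"
      using cB \<open>0 \<le> \<beta>\<close> mult_right_mono[of "real (card I) + real (card I')" "2 * real B" \<beta>]
      by (simp add: distrib_right)
    finally have "real P ^ 2 * (card I * card I') \<le> real P ^ 2 * (2 * B * \<beta>)"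
      by (intro mult_left_mono) auto
    moreover have "real B * B \<le> real P ^ 2 * (card I * card I')"
    proof -
      have "B * B \<le> (P * card I) * (P * card I')" using cI by (rule mult_le_mono)
      then have "real (B * B) \<le> real ((P * card I) * (P * card I'))" by (simp only: of_nat_le_iff)
      then show ?thesis by (simp add: power2_eq_square mult_ac)
    qed
    moreover have "real B * (2 * P\<^sup>2 * \<beta>) < real B * B"
      using B B0 by (intro mult_strict_left_mono) auto
    ultimately show False by (simp add: mult_ac)
  qed
  then obtain i j where ij: "i \<in> I" "j \<in> I'" "\<not> bad1 (i + m) (j - m)" "\<not> bad2 (i + m) (j - m)"
    by blast
  show thesis
    by (rule that[OF _ _ _ ij(3,4)]) (use far[OF ij(1,2)] ij(1,2) in \<open>auto simp: I_def I'_def\<close>)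
qed

text \<open>Domination comes in two stages: moving the start to \<open>i + m\<close> costs at most
  \<open>c\<close> for the best score \<open>G\<close>, then moving the end to \<open>j - m\<close>
  costs at most another \<open>c\<close> for \<open>F\<close>.\<close>

lemma good_pair:
  fixes b :: "nat \<Rightarrow> nat \<Rightarrow> real" and P B N m :: nat and e c \<epsilon> :: real
  assumes sub: "\<And>s t u. s \<le> t \<Longrightarrow> t \<le> u \<Longrightarrow> u \<le> N \<Longrightarrow> b s u \<le> b s t + b t u"
    and refl: "\<And>t. b t t = 0"
    and up: "\<And>s t. s \<le> t \<Longrightarrow> t \<le> N \<Longrightarrow> b s t \<le> e * (real t - s) + c"
    and low: "- (e * N) \<le> b 0 N"
    and "0 \<le> e" "0 < \<epsilon>" "0 \<le> c"
    and col: "\<And>i. col i < P"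
    and N: "N = (2 * P + 1) * B"
    and B: "2 * m \<le> B" "2 * P\<^sup>2 * (2 * e * N + 2 * c) < \<epsilon> * B"
  obtains i j where "i + B < j" "j \<le> N" "col i = col j"
    "\<And>s t. i + m \<le> s \<Longrightarrow> s \<le> t \<Longrightarrow> t + m \<le> j \<Longrightarrow>
      b s t + \<epsilon> * (real t - s) \<le> b (i + m) (j - m) + \<epsilon> * (real (j - m) - (i + m)) + 2 * c"
proof -
  define F where "F = (\<lambda>s t. b s t + \<epsilon> * (real t - s))"
  define G where "G = (\<lambda>s t. Max ((\<lambda>t'. F s t') ` {s..t}))"
  define bad1 where "bad1 s t \<longleftrightarrow> (\<exists>t'\<in>{s..<t}. F s t + c < F s t')" for s t
  define bad2 where "bad2 s t \<longleftrightarrow> (\<exists>s'\<in>{s<..t}. G s t + c < G s' t)" for s t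
  define \<beta> where "\<beta> = (2 * e * N + 2 * c) / \<epsilon>"
  obtain i j where ij: "i + B < j" "j \<le> N" "col i = col j"
    "\<not> bad1 (i + m) (j - m)" "\<not> bad2 (i + m) (j - m)"
  proof (rule same_colour_good_pair[of col P m B \<beta> N bad1 bad2, OF col B(1) _ N])
    show "real (2 * P\<^sup>2) * \<beta> < B" using B(2) \<open>0 < \<epsilon>\<close> by (simp add: \<beta>_def field_simps)
    show "card {t\<in>{s<..N}. bad1 s t} \<le> \<beta>" if "s \<le> N" for s
      using card_bad_ends[OF sub refl up low \<open>0 \<le> e\<close> \<open>0 < \<epsilon>\<close> \<open>0 \<le> c\<close> that] \<open>0 < \<epsilon>\<close>
      by (simp add: \<beta>_def bad1_def F_def field_simps)
    show "card {s\<in>{..<t}. bad2 s t} \<le> \<beta>" if "t \<le> N" for t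
      using card_bad_starts[OF sub refl up low \<open>0 \<le> e\<close> \<open>0 < \<epsilon>\<close> \<open>0 \<le> c\<close> that] \<open>0 < \<epsilon>\<close>
      by (simp add: \<beta>_def bad2_def F_def G_def field_simps)
  qed
  have "F s t \<le> F (i + m) (j - m) + 2 * c" if st: "i + m \<le> s" "s \<le> t" "t + m \<le> j" for s t
  proof -
    have G: "F s t \<le> G s (j - m)" unfolding G_def using st by (intro Max_ge) auto
    have 1: "G s (j - m) \<le> G (i + m) (j - m) + c"
      using ij(5) st \<open>0 \<le> c\<close> unfolding bad2_def by (cases "s = i + m") (auto simp: not_less)
    have "F (i + m) t' \<le> F (i + m) (j - m) + c" if "i + m \<le> t'" "t' \<le> j - m" for t'
      using ij(4) that \<open>0 \<le> c\<close> unfolding bad1_def by (cases "t' = j - m") (auto simp: not_less)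
    then have "G (i + m) (j - m) \<le> F (i + m) (j - m) + c"
      unfolding G_def using st by (subst Max_le_iff) auto
    then show ?thesis using G 1 by simp
  qed
  with ij show thesis using that unfolding F_def by auto
qed

section \<open>Periodic growth rates\<close>

text \<open>Total boundedness gives a finite net of radius \<open>\<delta> / 2\<close>; the colour
  of a point is the index of a nearby centre.\<close>

lemma compact_colouring:
  assumes "compact (UNIV :: 'a::metric_space set)" "0 < \<delta>"
  obtains col :: "'a::metric_space \<Rightarrow> nat" and P where "\<And>x. col x < P" "\<And>x y. col x = col y \<Longrightarrow> dist x y < \<delta>"
proof -
  obtain S :: "'a set" where S: "finite S" "UNIV \<subseteq> (\<Union>c\<in>S. ball c (\<delta> / 2))"
    using assms half_gt_zero[of \<delta>] unfolding compact_eq_totally_bounded by blast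
  obtain g :: "nat \<Rightarrow> 'a" where g: "S = g ` {..<card S}"
    using S(1) by (metis atLeast0LessThan bij_betw_imp_surj_on ex_bij_betw_nat_finite)
  have "\<exists>i<card S. dist (g i) x < \<delta> / 2" for x
  proof -
    obtain c where "c \<in> S" "dist c x < \<delta> / 2" using S(2) by (auto simp: subset_eq)
    moreover from this g obtain i where "i < card S" "c = g i" by blast
    ultimately show ?thesis by auto
  qed
  then obtain col where col: "\<And>x. col x < card S" "\<And>x. dist (g (col x)) x < \<delta> / 2" by metis
  show thesis
  proof
    show "col x < card S" for x by (rule col)
    show "dist x y < \<delta>" if "col x = col y" for x y
      using dist_triangle_half_r[of "g (col x)" x \<delta> y] col(2)[of x] col(2)[of y] that by simp
  qed
qed

text \<open>The first and last \<open>m\<close> steps are removed by composing with their inverses,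
  each of norm at most \<open>K ^ m\<close>.\<close>

lemma norm_middle_le:
  assumes "\<forall>x. A x \<in> GL" "\<And>x. norm (GL_inv (A x)) \<le> K" "1 \<le> K"
  shows "norm (cocycle_nat f A ((f ^^ m) p) n) \<le> K ^ (2 * m) * norm (cocycle_nat f A p (m + n + m))"
proof -
  let ?W = "cocycle_nat f A"
  define R where "R = ?W p m"
  define U where "U = ?W ((f ^^ (m + n)) p) m"
  have GL: "R \<in> GL" "U \<in> GL" using assms(1) by (auto simp: R_def U_def cocycle_nat_GL)
  have nR: "norm (GL_inv R) \<le> K ^ m" "norm (GL_inv U) \<le> K ^ m"
    using norm_GL_inv_cocycle_nat_le[OF assms] by (auto simp: R_def U_def)
  have "?W p (m + n + m) = U o\<^sub>L (?W ((f ^^ m) p) n o\<^sub>L R)"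
    by (simp add: R_def U_def cocycle_nat_add[of f A p "m + n" m] cocycle_nat_add[of f A p m n])
  then have "?W ((f ^^ m) p) n = GL_inv U o\<^sub>L ?W p (m + n + m) o\<^sub>L GL_inv R"
    by (intro blinfun_eqI) (simp add: GL_inv_apply GL)
  then have "norm (?W ((f ^^ m) p) n) \<le> norm (GL_inv U) * norm (?W p (m + n + m)) * norm (GL_inv R)"
    by (auto intro!: order_trans[OF norm_blinfun_compose] mult_right_mono norm_blinfun_compose)
  also have "\<dots> \<le> K ^ m * norm (?W p (m + n + m)) * K ^ m"
    using nR assms(3) by (intro mult_mono) auto
  finally show ?thesis by (simp add: power_add mult_2 mult_2_right mult_ac)
qed

text \<open>The case of growth rate zero, to which the general case is rescaled. The block length
  \<open>B\<close> forces the period above \<open>k0\<close>.\<close>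

lemma periodic_growth_normalised:
  fixes f :: "'a::metric_space \<Rightarrow> 'a" and A :: "'a \<Rightarrow> ('v::real_normed_vector \<Rightarrow>\<^sub>L 'v)"
    and K M \<alpha> \<delta> \<eta> :: real and k0 :: nat
  defines "W \<equiv> cocycle_nat f A"
  assumes cpt: "compact (UNIV :: 'a set)" and closing: "closing_property f"
    and GL: "\<forall>x. A x \<in> GL" and K: "\<And>x. norm (GL_inv (A x)) \<le> K" "1 \<le> K"
    and holder: "0 < \<alpha>" "0 < M" "0 < \<delta>"
      "\<And>x y. dist x y < \<delta> \<Longrightarrow> norm (A x - A y) \<le> M * dist x y powr \<alpha>"
    and up: "\<And>\<epsilon>. 0 < \<epsilon> \<Longrightarrow> \<exists>C. \<forall>x n. norm (W x n) \<le> C * exp (\<epsilon> * real n)"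
    and low: "\<And>\<epsilon> n. 0 < \<epsilon> \<Longrightarrow> \<exists>x. exp (- (\<epsilon> * real n)) \<le> norm (W x n)"
    and \<eta>: "0 < \<eta>"
  shows "\<exists>k\<ge>k0. \<exists>p. (f ^^ k) p = p \<and> exp (- (\<eta> * real k)) \<le> norm (W p k)"
proof -
  obtain D \<gamma> \<delta>\<^sub>0 where cl: "D > 0" "\<gamma> > 0" "\<delta>\<^sub>0 > 0"
    "\<And>x k. 1 \<le> k \<Longrightarrow> dist x ((f ^^ k) x) < \<delta>\<^sub>0 \<Longrightarrow>
        \<exists>p. (f ^^ k) p = p \<and> (\<forall>i\<le>k. dist ((f ^^ i) x) ((f ^^ i) p)
            \<le> D * dist x ((f ^^ k) x) * exp (- \<gamma> * real (min i (k - i))))"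
    using closing unfolding closing_property_def by metis
  \<comment> \<open>The first bound lets the decay \<open>\<gamma> * \<alpha>\<close> of the
    generator differences dominate the rate \<open>4 * \<epsilon>\<close> asked for by
    \<open>closing_estimate\<close>; the second keeps half of \<open>\<eta>\<close> for the
    constants.\<close>
  define \<epsilon> where "\<epsilon> = min (\<gamma> * \<alpha> / 4) (\<eta> / 2)"
  have \<epsilon>: "0 < \<epsilon>" "4 * \<epsilon> \<le> \<gamma> * \<alpha>" "\<epsilon> \<le> \<eta> / 2" using cl holder \<eta> by (auto simp: \<epsilon>_def)
  \<comment> \<open>The order of choices avoids circularity: \<open>P\<close> fixes \<open>e\<close>, which fixes \<open>C\<close> and \<open>L\<close>, which fix \<open>m\<close>.\<close>
  obtain col :: "'a \<Rightarrow> nat" and P where col: "\<And>x. col x < P" "\<And>x y. col x = col y \<Longrightarrow> dist x y < \<delta>\<^sub>0"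
    using compact_colouring[OF cpt cl(3)] by metis
  have P: "1 \<le> P" using col(1) by (metis less_one not_le not_less_zero)
  \<comment> \<open>Chosen so that \<open>2 * P\<^sup>2 * (2 * e * N)\<close> equals
    \<open>\<epsilon> * B / 2\<close>, half of what \<open>good_pair\<close> allows.\<close>
  define e where "e = \<epsilon> / (8 * real P ^ 2 * (2 * P + 1))"
  have P2: "1 \<le> real P ^ 2" using P by simp
  have e: "0 < e" using \<epsilon> P by (simp add: e_def)
  have "1 * 1 \<le> (8 * real P ^ 2) * (2 * P + 1)" using P2 by (intro mult_mono) auto
  then have "\<epsilon> / (8 * real P ^ 2 * (2 * P + 1)) \<le> \<epsilon> / 1"
    using \<epsilon> by (intro divide_left_mono) auto
  then have e\<epsilon>: "e \<le> \<epsilon>" by (simp add: e_def)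
  obtain C0 where C0: "\<And>x n. norm (W x n) \<le> C0 * exp (e * real n)" using up[OF e] by metis
  define C where "C = max 1 C0"
  have C: "1 \<le> C" and Ce: "norm (W x n) \<le> C * exp (e * real n)" for x n
  proof -
    show "1 \<le> C" by (simp add: C_def)
    have "C0 * exp (e * real n) \<le> C * exp (e * real n)"
      by (rule mult_right_mono) (auto simp: C_def)
    then show "norm (W x n) \<le> C * exp (e * real n)" using C0[of x n] by linarith
  qed
  have C\<epsilon>: "norm (W x n) \<le> C * exp (\<epsilon> * real n)" for x n
  proof -
    have "C * exp (e * real n) \<le> C * exp (\<epsilon> * real n)" using C e\<epsilon> by (simp add: mult_right_mono)
    then show ?thesis using Ce[of x n] by linarith
  qed
  define c where "c = ln C"
  have c: "0 \<le> c" "exp c = C" using C by (auto simp: c_def)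
  \<comment> \<open>The additive loss \<open>2 * c\<close> in \<open>good_pair\<close> becomes the
    factor \<open>L\<close> after exponentiation.\<close>
  define L where "L = C\<^sup>2"
  have L: "1 \<le> L" "exp (2 * c) = L" using C c by (auto simp: L_def exp_double)
  \<comment> \<open>The lower bound at time 0 forces the space to be nonzero; hence all cocycle
    norms are positive and have meaningful logarithms.\<close>
  have n1: "norm (id_blinfun :: 'v \<Rightarrow>\<^sub>L 'v) = 1"
    using low[OF e, of 0] norm_blinfun_id_le[where 'a = 'v] by (auto simp: W_def)
  then obtain v :: 'v where v: "v \<noteq> 0"
    by (metis blinfun_apply_id_blinfun blinfun_eqI norm_zero zero_blinfun.rep_eq zero_neq_one)
  have Wpos: "0 < norm (W x n)" for x n
    unfolding W_def using cocycle_nat_GL[OF GL] norm_GL_pos[OF _ v] by blast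
  \<comment> \<open>\<open>\<rho> m\<close> bounds the distance to the closing orbit at depth
    \<open>m\<close> from the ends, and \<open>\<kappa> m\<close> the resulting difference of
    generators; both tend to 0.\<close>
  define \<rho> where "\<rho> m = D * \<delta>\<^sub>0 * exp (- (\<gamma> * real m))" for m :: nat
  define \<kappa> where "\<kappa> m = M * \<rho> m powr \<alpha>" for m
  have \<rho>0: "\<rho> \<longlonglongrightarrow> 0"
  proof -
    have "(\<lambda>m. D * \<delta>\<^sub>0 * exp (- \<gamma>) ^ m) \<longlonglongrightarrow> D * \<delta>\<^sub>0 * 0"
      using cl by (intro tendsto_intros LIMSEQ_power_zero) auto
    then show ?thesis by (simp add: \<rho>_def[abs_def] exp_of_nat_mult[symmetric] mult_ac)
  qed
  have \<rho>pos: "0 < \<rho> m" for m using cl by (simp add: \<rho>_def)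
  have "(\<lambda>m. 8 * L * C * (M * \<rho> m powr \<alpha>) * exp \<epsilon>) \<longlonglongrightarrow> 8 * L * C * (M * 0) * exp \<epsilon>"
    using \<rho>pos holder(1)
    by (intro tendsto_intros tendsto_zero_powrI[OF \<rho>0 tendsto_const])
      (auto intro: less_imp_le always_eventually)
  then have "\<forall>\<^sub>F m in sequentially. 8 * L * C * \<kappa> m * exp \<epsilon> < 1 - exp (- (2 * \<epsilon>))"
    unfolding \<kappa>_def by (rule order_tendstoD) (use \<epsilon> in simp)
  moreover have "\<forall>\<^sub>F m in sequentially. \<rho> m < \<delta>" using order_tendstoD(2)[OF \<rho>0 holder(3)] .
  ultimately have "\<forall>\<^sub>F m in sequentially. \<rho> m < \<delta> \<and> 8 * L * C * \<kappa> m * exp \<epsilon> < 1 - exp (- (2 * \<epsilon>))"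
    by eventually_elim auto
  then obtain m where m: "\<rho> m < \<delta>" "8 * L * C * \<kappa> m * exp \<epsilon> \<le> 1 - exp (- (2 * \<epsilon>))"
    by (metis (mono_tags, lifting) eventually_happens' less_imp_le sequentially_bot)
  \<comment> \<open>The three bounds serve, in turn, to leave room for the trimmed ends and exceed
    \<open>k0\<close>, to meet the other half of the counting condition in \<open>good_pair\<close>,
    and to absorb \<open>2 * L * K ^ (2 * m)\<close> into
    \<open>exp (\<eta> / 2 * k)\<close>.\<close>
  obtain B where B: "2 * m + k0 + 1 \<le> B" "8 * real P ^ 2 * c / \<epsilon> < B"
    "2 * ln (2 * L * K ^ (2 * m)) / \<eta> < B"
  proof -
    define B where "B = max (2 * m + k0 + 1) (max (nat \<lceil>8 * real P ^ 2 * c / \<epsilon>\<rceil> + 1)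
      (nat \<lceil>2 * ln (2 * L * K ^ (2 * m)) / \<eta>\<rceil> + 1))"
    show thesis by (rule that[of B]; unfold B_def; linarith)
  qed
  define N where "N = (2 * P + 1) * B"
  obtain x where x: "exp (- (e * real N)) \<le> norm (W x N)" using low[OF e] by metis
  define b where "b s t = ln (norm (W ((f ^^ s) x) (t - s)))" for s t
  obtain i j where ij: "i + B < j" "j \<le> N" "col ((f ^^ i) x) = col ((f ^^ j) x)"
    "\<And>s t. i + m \<le> s \<Longrightarrow> s \<le> t \<Longrightarrow> t + m \<le> j \<Longrightarrow>
      b s t + \<epsilon> * (real t - s) \<le> b (i + m) (j - m) + \<epsilon> * (real (j - m) - (i + m)) + 2 * c"
  proof (rule good_pair[of N b e c \<epsilon> "\<lambda>i. col ((f ^^ i) x)" P B m])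
    fix s t u :: nat assume st: "s \<le> t" "t \<le> u"
    then have "W ((f ^^ s) x) (u - s) = W ((f ^^ t) x) (u - t) o\<^sub>L W ((f ^^ s) x) (t - s)"
      using cocycle_nat_add[of f A "(f ^^ s) x" "t - s" "u - t"]
      by (simp add: W_def comp_apply[symmetric, of "f ^^ _"] funpow_add[symmetric] del: comp_apply)
    then have "norm (W ((f ^^ s) x) (u - s)) \<le> norm (W ((f ^^ t) x) (u - t)) * norm (W ((f ^^ s) x) (t - s))"
      by (simp add: norm_blinfun_compose)
    then have "ln (norm (W ((f ^^ s) x) (u - s))) \<le>
        ln (norm (W ((f ^^ t) x) (u - t)) * norm (W ((f ^^ s) x) (t - s)))"
      by (rule ln_mono[OF _ Wpos])
    also have "\<dots> = ln (norm (W ((f ^^ t) x) (u - t))) + ln (norm (W ((f ^^ s) x) (t - s)))"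
      by (rule ln_mult_pos[OF Wpos Wpos])
    finally show "b s u \<le> b s t + b t u" by (simp add: b_def)
  next
    show "b t t = 0" for t by (simp add: b_def W_def n1)
  next
    fix s t :: nat assume "s \<le> t"
    have "b s t \<le> ln (C * exp (e * real (t - s)))"
      unfolding b_def using Ce Wpos C by (subst ln_le_cancel_iff) (auto intro: mult_pos_pos)
    then show "b s t \<le> e * (real t - s) + c"
      using C \<open>s \<le> t\<close> by (simp add: ln_mult c_def of_nat_diff)
  next
    have "ln (exp (- (e * real N))) \<le> ln (norm (W x N))"
      using x Wpos by (subst ln_le_cancel_iff) auto
    then show "- (e * real N) \<le> b 0 N" by (simp add: b_def)
  next
    have "real P \<noteq> 0" using P by simp
    moreover have "e * N = \<epsilon> * B / (8 * real P ^ 2)"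
    proof -
      have "real N = real (2 * P + 1) * B" "e = \<epsilon> / (8 * real P ^ 2) / real (2 * P + 1)"
        by (simp_all add: N_def e_def distrib_right)
      then show ?thesis by (simp del: of_nat_add of_nat_mult of_nat_Suc add: field_simps)
    qed
    ultimately have "2 * real P ^ 2 * (2 * (e * N) + 2 * c) = \<epsilon> * B / 2 + 4 * real P ^ 2 * c"
      by (simp add: field_simps)
    also have "\<dots> < \<epsilon> * B" using B(2) \<epsilon>(1) by (simp add: field_simps)
    finally show "real (2 * P\<^sup>2) * (2 * e * real N + 2 * c) < \<epsilon> * real B" by (simp add: mult.assoc)
  next
    show "2 * m \<le> B" using B(1) by simp
  qed (use e c \<epsilon> col N_def in auto)
  \<comment> \<open>\<open>k\<close> is the period of the orbit closing the segment from
    \<open>i\<close> to \<open>j\<close>; \<open>n\<close> is the length left after trimming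
    \<open>m\<close> steps at both ends.\<close>
  define k where "k = j - i"
  define n where "n = j - m - (i + m)"
  define x0 where "x0 = (f ^^ i) x"
  define y where "y = (f ^^ m) x0"
  have kn: "k = m + n + m" "B < k" "n \<le> k" using ij(1) B(1) by (auto simp: k_def n_def)
  have "(f ^^ k) x0 = (f ^^ j) x"
    using ij(1) by (simp add: k_def x0_def comp_apply[symmetric, of "f ^^ _"] funpow_add[symmetric] del: comp_apply)
  then have d0: "dist x0 ((f ^^ k) x0) < \<delta>\<^sub>0" using ij(3) col(2) by (simp add: x0_def)
  then obtain p where p: "(f ^^ k) p = p" "\<And>i. i \<le> k \<Longrightarrow> dist ((f ^^ i) x0) ((f ^^ i) p)
            \<le> D * dist x0 ((f ^^ k) x0) * exp (- \<gamma> * real (min i (k - i)))"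
    using cl(4)[of k x0] kn(2) by fastforce
  define q where "q = (f ^^ m) p"
  have fi: "(f ^^ i') y = (f ^^ (i' + m)) x0" "(f ^^ i') q = (f ^^ (i' + m)) p" for i'
    by (simp_all add: y_def q_def funpow_add)
  have fy: "(f ^^ i') y = (f ^^ (i + m + i')) x" for i'
    by (simp add: fi x0_def comp_apply[symmetric, of "f ^^ _"] funpow_add[symmetric] add_ac del: comp_apply)
  have jn: "real (j - m) - (i + m) = n" using ij(1) B(1) by (simp add: n_def of_nat_diff)
  have bj: "b (i + m) (j - m) = ln (norm (W y n))" by (simp add: b_def n_def fy[of 0, simplified])
  note good = ij(4)[unfolded jn bj]
  have "norm (W q n) \<ge> norm (W y n) / 2"
    unfolding W_def
  proof (rule closing_estimate[OF \<epsilon>(1) C L(1), of "\<kappa> m"])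
    show "0 \<le> \<kappa> m" using holder by (simp add: \<kappa>_def)
    show "norm (cocycle_nat f A z j) \<le> C * exp (\<epsilon> * j)" for z and j :: nat
      using C\<epsilon> by (simp add: W_def)
    show "8 * L * C * \<kappa> m * exp \<epsilon> \<le> 1 - exp (- (2 * \<epsilon>))" by (rule m)
  next
    fix i' j' :: nat assume ij': "i' + j' \<le> n"
    have "b (i + m + i') (i + m + i' + j') + \<epsilon> * (real (i + m + i' + j') - real (i + m + i'))
      \<le> ln (norm (W y n)) + \<epsilon> * n + 2 * c"
      using ij' kn B(1) by (intro good) (auto simp: n_def)
    then have "ln (norm (W ((f ^^ i') y) j')) \<le> ln (norm (W y n)) + \<epsilon> * (real n - j') + 2 * c"
      by (simp add: b_def fy algebra_simps)
    then have "exp (ln (norm (W ((f ^^ i') y) j'))) \<le> exp (ln (norm (W y n)) + \<epsilon> * (real n - j') + 2 * c)"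
      by simp
    then show "norm (cocycle_nat f A ((f ^^ i') y) j') \<le> L * exp (\<epsilon> * (real n - real j')) * norm (cocycle_nat f A y n)"
      using Wpos by (simp only: exp_add L(2) exp_ln) (simp add: W_def mult_ac)
  next
    fix i' :: nat assume i': "i' < n"
    let ?d = "dist ((f ^^ i') q) ((f ^^ i') y)" and ?mn = "min i' (n - i')"
    \<comment> \<open>Trimming puts every time at depth at least \<open>m\<close>, so the closing
      bound splits into \<open>\<rho> m\<close> and a decay inside the trimmed segment.\<close>
    have "min (i' + m) (k - (i' + m)) = m + ?mn" using i' kn by auto
    then have "?d \<le> D * dist x0 ((f ^^ k) x0) * exp (- \<gamma> * real (m + ?mn))"
      using p(2)[of "i' + m"] i' kn by (simp add: fi dist_commute)
    also have "\<dots> \<le> D * \<delta>\<^sub>0 * exp (- \<gamma> * real (m + ?mn))"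
      using d0 cl by (intro mult_right_mono mult_left_mono) auto
    also have "\<dots> = \<rho> m * exp (- \<gamma> * real ?mn)"
      by (simp add: \<rho>_def exp_add[symmetric] algebra_simps)
    finally have d: "?d \<le> \<rho> m * exp (- \<gamma> * real ?mn)" .
    also have "\<dots> \<le> \<rho> m * 1" using \<rho>pos[of m] cl by (intro mult_left_mono) auto
    finally have "?d < \<delta>" using m by simp
    then have "norm (A ((f ^^ i') q) - A ((f ^^ i') y)) \<le> M * ?d powr \<alpha>" by (rule holder)
    also have "\<dots> \<le> M * (\<rho> m * exp (- \<gamma> * real ?mn)) powr \<alpha>"
      using d holder by (intro mult_left_mono powr_mono2) auto
    also have "\<dots> = \<kappa> m * exp (- (\<gamma> * \<alpha>) * real ?mn)"
      using \<rho>pos[of m] by (simp add: \<kappa>_def powr_mult exp_powr_real mult_ac)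
    also have "\<dots> \<le> \<kappa> m * exp (- (4 * \<epsilon>) * real ?mn)"
    proof (rule mult_left_mono)
      have "4 * \<epsilon> * real ?mn \<le> \<gamma> * \<alpha> * real ?mn" using \<epsilon>(2) by (intro mult_right_mono) auto
      then show "exp (- (\<gamma> * \<alpha>) * real ?mn) \<le> exp (- (4 * \<epsilon>) * real ?mn)" by simp
    qed (use holder in \<open>simp add: \<kappa>_def\<close>)
    finally show "norm (A ((f ^^ i') q) - A ((f ^^ i') y)) \<le> \<kappa> m * exp (- (4 * \<epsilon>) * real ?mn)" .
  qed
  also have "norm (W q n) \<le> K ^ (2 * m) * norm (W p k)"
    unfolding W_def q_def kn(1) by (rule norm_middle_le[OF GL K])
  finally have qp: "norm (W y n) \<le> 2 * K ^ (2 * m) * norm (W p k)" by simp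
  \<comment> \<open>Comparison with the empty segment turns domination into the lower bound
    \<open>exp (- \<epsilon> * n) / L\<close> for the norm of the good segment.\<close>
  have "b (i + m) (i + m) + \<epsilon> * (real (i + m) - real (i + m))
      \<le> ln (norm (W y n)) + \<epsilon> * n + 2 * c"
    using ij(1) B(1) by (intro good) auto
  then have "0 \<le> ln (norm (W y n)) + \<epsilon> * n + 2 * c" by (simp add: b_def W_def n1)
  then have "exp 0 \<le> exp (ln (norm (W y n)) + \<epsilon> * n + 2 * c)" by (simp only: exp_le_cancel_iff)
  then have "1 \<le> norm (W y n) * exp (\<epsilon> * n) * L" using Wpos by (simp only: exp_add L(2) exp_ln exp_zero)
  also have "\<dots> \<le> (2 * K ^ (2 * m) * norm (W p k)) * exp (\<epsilon> * k) * L"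
    using qp L(1) K kn \<epsilon>(1) by (intro mult_mono) auto
  also have "\<dots> = (2 * L * K ^ (2 * m)) * exp (\<epsilon> * k) * norm (W p k)" by (simp add: mult_ac)
  also have "\<dots> \<le> exp (\<eta> / 2 * k) * exp (\<eta> / 2 * k) * norm (W p k)"
  proof (intro mult_mono mult_right_mono)
    have "0 < 2 * L * K ^ (2 * m)" using L(1) K(2) by simp
    moreover have "ln (2 * L * K ^ (2 * m)) \<le> \<eta> / 2 * k"
    proof -
      have "2 * ln (2 * L * K ^ (2 * m)) / \<eta> < k" using B(3) kn(2) by linarith
      then show ?thesis using \<eta> by (simp add: field_simps)
    qed
    ultimately show "2 * L * K ^ (2 * m) \<le> exp (\<eta> / 2 * k)" by (metis exp_le_cancel_iff exp_ln)
    show "exp (\<epsilon> * k) \<le> exp (\<eta> / 2 * k)" using \<epsilon>(3) by (simp only: exp_le_cancel_iff) (intro mult_right_mono, auto)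
  qed auto
  also have "\<dots> = exp (\<eta> * k) * norm (W p k)" by (simp add: exp_add[symmetric])
  finally have "exp (- (\<eta> * real k)) \<le> norm (W p k)" by (simp add: exp_minus field_simps)
  then show ?thesis using p(1) kn(2) B(1) by (intro exI[of _ k]) auto
qed

section \<open>The exponential growth rate and the reduction to rate zero\<close>

lemma norm_id_blinfun_eq_1:
  assumes "(v::'v::real_normed_vector) \<noteq> 0"
  shows "norm (id_blinfun :: 'v \<Rightarrow>\<^sub>L 'v) = 1"
proof -
  have "norm v \<le> norm (id_blinfun :: 'v \<Rightarrow>\<^sub>L 'v) * norm v"
    using norm_blinfun[of "id_blinfun :: 'v \<Rightarrow>\<^sub>L 'v" v] by simp
  then show ?thesis using assms norm_blinfun_id_le[where 'a = 'v] by simp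
qed

text \<open>On each ball of a finite cover, \<open>A\<close> and its inverse differ from their
  values at the centre by at most \<open>M * \<delta> powr \<alpha>\<close>; the sum over the
  centres stands in for a maximum.\<close>

lemma holder_GL_bounded:
  fixes A :: "'a::metric_space \<Rightarrow> ('v::real_normed_vector \<Rightarrow>\<^sub>L 'v)"
  assumes "compact (UNIV :: 'a set)" "holder_GL A"
  obtains K where "1 \<le> K" "\<And>x. norm (A x) \<le> K" "\<And>x. norm (GL_inv (A x)) \<le> K"
proof -
  obtain \<alpha> M \<delta> where h: "0 < \<alpha>" "0 < M" "0 < \<delta>"
    "\<And>x y. dist x y < \<delta> \<Longrightarrow> GL_dist (A x) (A y) \<le> M * dist x y powr \<alpha>"
    using assms(2) unfolding holder_GL_def by metis
  obtain S :: "'a set" where S: "finite S" "UNIV \<subseteq> (\<Union>c\<in>S. ball c \<delta>)"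
    using assms(1) h(3) unfolding compact_eq_totally_bounded by blast
  define g where "g c = norm (A c) + norm (GL_inv (A c))" for c
  define K where "K = 1 + (\<Sum>c\<in>S. g c) + M * \<delta> powr \<alpha>"
  have g0: "0 \<le> g c" for c by (simp add: g_def)
  have K1: "1 \<le> K" using h sum_nonneg[of S g] g0 by (simp add: K_def add_increasing2)
  have "g x \<le> K" for x
  proof -
    obtain c where c: "c \<in> S" "dist c x < \<delta>" using S(2) by (auto simp: subset_eq)
    have "g x \<le> g c + GL_dist (A x) (A c)"
      using norm_triangle_ineq2[of "A x" "A c"] norm_triangle_ineq2[of "GL_inv (A x)" "GL_inv (A c)"]
      by (simp add: g_def GL_dist_def)
    also have "GL_dist (A x) (A c) \<le> M * dist x c powr \<alpha>" using h(4)[of x c] c by (simp add: dist_commute)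
    also have "\<dots> \<le> M * \<delta> powr \<alpha>" using h c by (intro mult_left_mono powr_mono2) (auto simp: dist_commute)
    also have "g c \<le> (\<Sum>c\<in>S. g c)" using c S g0 by (intro member_le_sum) auto
    finally show ?thesis by (simp add: K_def)
  qed
  then show thesis using K1 that[of K] unfolding g_def
    by (smt (verit) norm_ge_zero)
qed

lemma exp_unbounded:
  fixes d C :: real
  assumes "0 < d" "\<And>k0. \<exists>k\<ge>k0. exp (d * real k) \<le> C"
  shows False
proof -
  obtain k where "nat \<lceil>C / d\<rceil> \<le> k" and k: "exp (d * real k) \<le> C" using assms(2) by blast
  then have "C / d \<le> real k" by linarith
  then have "C \<le> d * real k" using assms(1) by (simp add: field_simps)
  then show False using k exp_ge_add_one_self[of "d * real k"] by linarith
qed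

lemma GL_scaleR:
  assumes "T \<in> GL" "c \<noteq> 0"
  shows "c *\<^sub>R T \<in> GL" and "GL_inv (c *\<^sub>R T) = inverse c *\<^sub>R GL_inv T"
proof -
  have *: "(c *\<^sub>R T) o\<^sub>L (inverse c *\<^sub>R GL_inv T) = id_blinfun"
    "(inverse c *\<^sub>R GL_inv T) o\<^sub>L (c *\<^sub>R T) = id_blinfun"
    by (rule blinfun_eqI, simp add: blinfun.bilinear_simps GL_inv_apply assms)+
  show "c *\<^sub>R T \<in> GL" using * unfolding GL_def by blast
  show "GL_inv (c *\<^sub>R T) = inverse c *\<^sub>R GL_inv T" by (rule GL_inv_eq[OF *])
qed

text \<open>\<open>\<mu>\<close> is the infimum of the exponents that bound the growth up to a
  constant. The bounds on \<open>A\<close> and its inverse make it finite; submultiplicativity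
  excludes a time \<open>n\<close> at which all norms lie below
  \<open>exp ((\<mu> - \<epsilon>) * n)\<close>. The periodic claim follows after scaling
  \<open>A\<close> by \<open>exp (- \<mu>)\<close>.\<close>

lemma periodic_growth:
  fixes f :: "'a::metric_space \<Rightarrow> 'a" and A :: "'a \<Rightarrow> ('v::real_normed_vector \<Rightarrow>\<^sub>L 'v)"
  defines "W \<equiv> cocycle_nat f A"
  assumes cpt: "compact (UNIV :: 'a set)" and closing: "closing_property f"
    and GL: "\<forall>x. A x \<in> GL" and holder: "holder_GL A" and v: "(v::'v) \<noteq> 0"
  obtains \<mu> :: real where
    "\<And>\<epsilon>. 0 < \<epsilon> \<Longrightarrow> \<exists>C. \<forall>x n. norm (W x n) \<le> C * exp ((\<mu> + \<epsilon>) * real n)"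
    "\<And>\<epsilon> n. 0 < \<epsilon> \<Longrightarrow> \<exists>x. exp ((\<mu> - \<epsilon>) * real n) \<le> norm (W x n)"
    "\<And>\<epsilon> k0. 0 < \<epsilon> \<Longrightarrow> \<exists>k\<ge>k0. \<exists>p. (f ^^ k) p = p \<and> exp ((\<mu> - \<epsilon>) * real k) \<le> norm (W p k)"
proof -
  obtain K where K: "1 \<le> K" "\<And>x. norm (A x) \<le> K" "\<And>x. norm (GL_inv (A x)) \<le> K"
    using holder_GL_bounded[OF cpt holder] by metis
  have Kexp: "K ^ n = exp (ln K * real n)" for n
    using K(1) by (simp add: exp_of_nat2_mult)
  have n1: "norm (id_blinfun :: 'v \<Rightarrow>\<^sub>L 'v) = 1" by (rule norm_id_blinfun_eq_1[OF v])
  define R where "R = {\<tau>. \<exists>C. \<forall>x n. norm (W x n) \<le> C * exp (\<tau> * real n)}"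
  have "ln K \<in> R"
    using norm_cocycle_nat_le[of A K f, OF K(2,1)] by (auto simp: R_def W_def Kexp intro!: exI[of _ 1])
  have lower: "- ln K \<le> \<tau>" if "\<tau> \<in> R" for \<tau>
  proof (rule ccontr)
    assume "\<not> - ln K \<le> \<tau>"
    then have pos: "0 < - ln K - \<tau>" by simp
    obtain C where C: "\<And>x n. norm (W x n) \<le> C * exp (\<tau> * real n)" using \<open>\<tau> \<in> R\<close> by (auto simp: R_def)
    have "exp ((- ln K - \<tau>) * real n) \<le> C" for n
    proof -
      \<comment> \<open>Any point will do: the identity factors through \<open>W x n\<close> and its
        inverse, the latter of norm at most \<open>K ^ n\<close>.\<close>
      fix x
      have "1 \<le> norm (GL_inv (W x n)) * norm (W x n)"
        using norm_blinfun_compose[of "GL_inv (W x n)" "W x n"] n1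
        by (simp add: W_def GL_inv_left cocycle_nat_GL GL)
      also have "\<dots> \<le> exp (ln K * real n) * (C * exp (\<tau> * real n))"
        using norm_GL_inv_cocycle_nat_le[OF GL K(3,1)] C
        by (intro mult_mono) (auto simp: W_def Kexp)
      finally have "1 * exp (- (ln K * real n + \<tau> * real n)) \<le>
          (C * exp (ln K * real n + \<tau> * real n)) * exp (- (ln K * real n + \<tau> * real n))"
        by (intro mult_right_mono) (auto simp: exp_add mult_ac)
      then have "exp (- (ln K * real n + \<tau> * real n)) \<le> C" by (simp add: mult.assoc exp_add[symmetric])
      then show ?thesis by (simp add: left_diff_distrib)
    qed
    then show False using exp_unbounded[OF pos, of C] by blast
  qed
  then have bdd: "bdd_below R" by (rule bdd_belowI)
  define \<mu> where "\<mu> = Inf R"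
  have up: "\<exists>C. \<forall>x n. norm (W x n) \<le> C * exp ((\<mu> + \<epsilon>) * real n)" if \<epsilon>: "0 < \<epsilon>" for \<epsilon>
  proof -
    obtain \<tau> where \<tau>: "\<tau> \<in> R" "\<tau> < \<mu> + \<epsilon>"
      using cInf_lessD[of R "\<mu> + \<epsilon>"] \<open>ln K \<in> R\<close> \<epsilon> by (auto simp: \<mu>_def)
    then obtain C where C: "\<And>x n. norm (W x n) \<le> C * exp (\<tau> * real n)" by (auto simp: R_def)
    \<comment> \<open>\<open>undefined\<close> stands for an arbitrary point, and time 0 isolates
      \<open>C\<close>.\<close>
    have "0 \<le> C" using C[of undefined 0] norm_ge_zero by (metis mult_zero_right exp_zero mult.right_neutral of_nat_0 order_trans)
    then have "C * exp (\<tau> * real n) \<le> C * exp ((\<mu> + \<epsilon>) * real n)" for n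
      using \<tau>(2) by (intro mult_left_mono) (auto intro!: mult_right_mono)
    then show ?thesis using C order_trans by blast
  qed
  have low: "\<exists>x. exp ((\<mu> - \<epsilon>) * real n) \<le> norm (W x n)" if \<epsilon>: "0 < \<epsilon>" for \<epsilon> n
  proof (rule ccontr)
    assume none: "\<not> ?thesis"
    then have less: "norm (W x n) \<le> exp ((\<mu> - \<epsilon>) * real n)" for x by (meson not_le less_imp_le)
    \<comment> \<open>At time 0 the identity, of norm 1, meets the bound; a failure thus has
      \<open>n > 0\<close> and allows division by \<open>n\<close>.\<close>
    have n: "0 < n" using none n1 by (cases n) (auto simp: W_def)
    have mult: "norm (W x (l + q * n)) \<le> K ^ l * exp ((\<mu> - \<epsilon>) * (n * q))" for x l q
    proof (induction q)
      case 0
      show ?case using norm_cocycle_nat_le[of A K f, OF K(2,1)] by (simp add: W_def)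
    next
      case (Suc q)
      have "W x (l + Suc q * n) = W ((f ^^ (l + q * n)) x) n o\<^sub>L W x (l + q * n)"
        by (simp add: W_def cocycle_nat_add[symmetric] add_ac)
      then have "norm (W x (l + Suc q * n)) \<le> norm (W ((f ^^ (l + q * n)) x) n) * norm (W x (l + q * n))"
        by (simp add: norm_blinfun_compose)
      also have "\<dots> \<le> exp ((\<mu> - \<epsilon>) * n) * (K ^ l * exp ((\<mu> - \<epsilon>) * (n * q)))"
        using less Suc.IH by (intro mult_mono) auto
      also have "\<dots> = K ^ l * exp ((\<mu> - \<epsilon>) * (n * Suc q))"
        by (simp add: exp_add[symmetric] distrib_left mult_ac)
      finally show ?case .
    qed
    have "norm (W x j) \<le> (K ^ n * exp (\<bar>\<mu> - \<epsilon>\<bar> * n)) * exp ((\<mu> - \<epsilon>) * j)" for x j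
    proof -
      \<comment> \<open>Division with remainder extends the bound from the one time \<open>n\<close>
        to all times; the absolute value covers either sign of \<open>\<mu> - \<epsilon>\<close> in
        the remainder.\<close>
      define l q where "l = j mod n" and "q = j div n"
      have j: "j = l + q * n" and l: "l \<le> n" using n by (auto simp: l_def q_def less_imp_le)
      have "- (\<mu> - \<epsilon>) * l \<le> \<bar>\<mu> - \<epsilon>\<bar> * n" using l by (intro mult_mono) auto
      then have *: "(\<mu> - \<epsilon>) * (n * q) \<le> \<bar>\<mu> - \<epsilon>\<bar> * n + (\<mu> - \<epsilon>) * j"
        by (simp add: j algebra_simps)
      have "norm (W x j) \<le> K ^ l * exp ((\<mu> - \<epsilon>) * (n * q))" using mult[of x l q] j by simp
      also have "\<dots> \<le> K ^ n * exp (\<bar>\<mu> - \<epsilon>\<bar> * n + (\<mu> - \<epsilon>) * j)"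
        using K(1) l * by (intro mult_mono power_increasing) auto
      finally show ?thesis by (simp add: exp_add mult.assoc)
    qed
    then have "\<mu> - \<epsilon> \<in> R" unfolding R_def by blast
    then show False using cInf_lower[OF _ bdd, of "\<mu> - \<epsilon>"] \<epsilon> by (simp add: \<mu>_def)
  qed
  have per: "\<exists>k\<ge>k0. \<exists>p. (f ^^ k) p = p \<and> exp ((\<mu> - \<epsilon>) * real k) \<le> norm (W p k)"
    if \<epsilon>: "0 < \<epsilon>" for \<epsilon> k0
  proof -
    obtain \<alpha> M \<delta> where h: "0 < \<alpha>" "0 < M" "0 < \<delta>"
      "\<And>x y. dist x y < \<delta> \<Longrightarrow> GL_dist (A x) (A y) \<le> M * dist x y powr \<alpha>"
      using holder unfolding holder_GL_def by metis
    \<comment> \<open>\<open>A'\<close> has growth rate zero; \<open>W'_le\<close> and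
      \<open>W'_ge\<close> translate bounds between the two cocycles.\<close>
    define A' where "A' x = exp (- \<mu>) *\<^sub>R A x" for x
    have W': "norm (cocycle_nat f A' x n) = exp (- \<mu> * real n) * norm (W x n)" for x n
      unfolding A'_def[abs_def] cocycle_nat_scaleR W_def
      by (simp add: exp_of_nat_mult[symmetric] mult.commute)
    have W'_le: "norm (cocycle_nat f A' x n) \<le> a * exp (b * real n) \<longleftrightarrow>
        norm (W x n) \<le> a * exp ((\<mu> + b) * real n)" for x n a b
    proof -
      have eq: "exp ((\<mu> + b) * real n) = exp (\<mu> * real n) * exp (b * real n)"
        by (simp add: distrib_right exp_add)
      show ?thesis unfolding W' eq by (simp add: exp_minus divide_simps mult_ac)
    qed
    have W'_ge: "exp (- (b * real n)) \<le> norm (cocycle_nat f A' x n) \<longleftrightarrow>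
        exp ((\<mu> - b) * real n) \<le> norm (W x n)" for x n b
    proof -
      have eq: "exp ((\<mu> - b) * real n) = exp (\<mu> * real n) * exp (- (b * real n))"
        by (simp add: left_diff_distrib exp_add[symmetric])
      show ?thesis unfolding W' eq by (simp add: exp_minus divide_simps mult_ac)
    qed
    have "\<exists>k\<ge>k0. \<exists>p. (f ^^ k) p = p \<and> exp (- (\<epsilon> * real k)) \<le> norm (cocycle_nat f A' p k)"
    proof (rule periodic_growth_normalised[OF cpt closing])
      show "\<forall>x. A' x \<in> GL" using GL by (simp add: A'_def GL_scaleR)
      show "norm (GL_inv (A' x)) \<le> max 1 (exp \<mu> * K)" for x
        using GL K(3)[of x] by (simp add: A'_def GL_scaleR exp_minus le_max_iff_disj)
      show "norm (A' x - A' y) \<le> (exp (- \<mu>) * M) * dist x y powr \<alpha>" if "dist x y < \<delta>" for x y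
      proof -
        have "norm (A x - A y) \<le> GL_dist (A x) (A y)" by (simp add: GL_dist_def)
        also have "\<dots> \<le> M * dist x y powr \<alpha>" by (rule h(4)[OF that])
        finally show ?thesis
          by (simp add: A'_def scaleR_diff_right[symmetric] mult.assoc)
      qed
      show "\<exists>C. \<forall>x n. norm (cocycle_nat f A' x n) \<le> C * exp (\<epsilon> * real n)" if "0 < \<epsilon>" for \<epsilon>
        using up[OF that] unfolding W'_le .
      show "\<exists>x. exp (- (\<epsilon> * real n)) \<le> norm (cocycle_nat f A' x n)" if "0 < \<epsilon>" for \<epsilon> n
        using low[OF that] unfolding W'_ge .
    qed (use h \<epsilon> in auto)
    then show ?thesis unfolding W'_ge .
  qed
  show thesis using that up low per by blast
qed

section \<open>Limits of \<open>n\<close>-th roots from exponential bounds\<close>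

lemma powr_inverse_le:
  assumes "0 < n" "0 \<le> y" "y \<le> exp (z * real n)"
  shows "y powr (1 / real n) \<le> exp z"
proof -
  have "y powr (1 / real n) \<le> exp (z * real n) powr (1 / real n)"
    using assms by (intro powr_mono2) auto
  then show ?thesis using assms by (simp add: exp_powr_real)
qed

lemma powr_inverse_ge:
  assumes "0 < n" "exp (z * real n) \<le> y"
  shows "exp z \<le> y powr (1 / real n)"
proof -
  have "exp (z * real n) powr (1 / real n) \<le> y powr (1 / real n)"
    using assms by (intro powr_mono2) auto
  then show ?thesis using assms by (simp add: exp_powr_real)
qed

text \<open>The conclusions of \<open>periodic_growth\<close>, for an abstract non-negative
  function; the limit statements follow from these alone.\<close>

locale exponential_growth =
  fixes f :: "'a \<Rightarrow> 'a" and \<phi> :: "'a \<Rightarrow> nat \<Rightarrow> real" and \<mu> :: real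
  assumes nonneg: "0 \<le> \<phi> x n"
    and upper: "0 < \<epsilon> \<Longrightarrow> \<exists>C. \<forall>x n. \<phi> x n \<le> C * exp ((\<mu> + \<epsilon>) * real n)"
    and lower: "0 < \<epsilon> \<Longrightarrow> \<exists>x. exp ((\<mu> - \<epsilon>) * real n) \<le> \<phi> x n"
    and periodic: "0 < \<epsilon> \<Longrightarrow> \<exists>k\<ge>k0. \<exists>p. (f ^^ k) p = p \<and> exp ((\<mu> - \<epsilon>) * real k) \<le> \<phi> p k"
begin

lemma eventually_le:
  assumes "0 < \<epsilon>"
  shows "\<forall>\<^sub>F n in sequentially. 0 < n \<and> (\<forall>x. \<phi> x n powr (1 / real n) \<le> exp (\<mu> + \<epsilon>))"
proof -
  obtain C where C: "\<And>x n. \<phi> x n \<le> C * exp ((\<mu> + \<epsilon> / 2) * real n)"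
    using upper[of "\<epsilon> / 2"] assms by auto
  have "\<phi> x n powr (1 / real n) \<le> exp (\<mu> + \<epsilon>)"
    if n: "nat \<lceil>2 * C / \<epsilon>\<rceil> < n" for n x
  proof (rule powr_inverse_le)
    show "0 < n" using n by simp
    have "2 * C / \<epsilon> \<le> n" using n by linarith
    then have "C \<le> \<epsilon> / 2 * n" using assms by (simp add: field_simps)
    also have "\<dots> \<le> exp (\<epsilon> / 2 * n)" using exp_ge_add_one_self[of "\<epsilon> / 2 * n"] by linarith
    finally have "C * exp ((\<mu> + \<epsilon> / 2) * real n) \<le> exp (\<epsilon> / 2 * n) * exp ((\<mu> + \<epsilon> / 2) * real n)"
      by (intro mult_right_mono) auto
    also have "\<dots> = exp ((\<mu> + \<epsilon>) * n)" by (simp add: exp_add[symmetric] algebra_simps)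
    finally show "\<phi> x n \<le> exp ((\<mu> + \<epsilon>) * n)" using C[of x n] by linarith
  qed (rule nonneg)
  then show ?thesis unfolding eventually_sequentially
    by (intro exI[of _ "Suc (nat \<lceil>2 * C / \<epsilon>\<rceil>)"]) auto
qed

text \<open>The bound in \<open>eventually_le\<close> is uniform in the point, so one threshold
  serves the supremum over the space and those over the fixed points of \<open>f ^^ k\<close>, a set
  that varies with \<open>k\<close>.\<close>

lemma eventually_SUP_less:
  assumes "ereal (exp \<mu>) < a"
  shows "\<forall>\<^sub>F n in sequentially. \<forall>S. (SUP x\<in>S. ereal (\<phi> x n powr (1 / real n))) < a"
proof -
  obtain r where r: "ereal (exp \<mu>) < ereal r" "ereal r < a" using assms ereal_dense2 by blast
  then have r0: "0 < r" by (simp add: less_trans[OF exp_gt_zero])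
  then have "\<mu> < ln r" using r(1) by (metis exp_less_cancel_iff exp_ln less_ereal.simps(1))
  then have "\<forall>\<^sub>F n in sequentially. 0 < n \<and> (\<forall>x. \<phi> x n powr (1 / real n) \<le> exp (\<mu> + (ln r - \<mu>)))"
    by (intro eventually_le) simp
  then show ?thesis
  proof eventually_elim
    case (elim n)
    have "(SUP x\<in>S. ereal (\<phi> x n powr (1 / real n))) \<le> ereal r" for S
      using elim r0 by (intro SUP_least) auto
    then show ?case using r(2) order_le_less_trans by blast
  qed
qed

lemma less_exp_rate:
  assumes "a < ereal (exp \<mu>)"
  obtains \<epsilon> where "0 < \<epsilon>" "a < ereal (exp (\<mu> - \<epsilon>))"
proof -
  obtain r where r: "a < ereal r" "ereal r < ereal (exp \<mu>)" using assms ereal_dense2 by blast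
  \<comment> \<open>\<open>r\<close> may be negative or zero; the maximum makes its logarithm
    meaningful.\<close>
  define r' where "r' = max r (exp \<mu> / 2)"
  have r': "0 < r'" "r' < exp \<mu>" using r(2) by (auto simp: r'_def less_max_iff_disj)
  then have "ln r' < \<mu>" by (metis exp_less_cancel_iff exp_ln)
  moreover have "a < ereal r'" by (rule less_le_trans[OF r(1)]) (simp add: r'_def)
  ultimately show thesis using that[of "\<mu> - ln r'"] r' by simp
qed

lemma tendsto_SUP: "(\<lambda>n. SUP x. ereal (\<phi> x n powr (1 / real n))) \<longlonglongrightarrow> ereal (exp \<mu>)"
proof (rule order_tendstoI)
  fix a assume "a < ereal (exp \<mu>)"
  then obtain \<epsilon> where \<epsilon>: "0 < \<epsilon>" "a < ereal (exp (\<mu> - \<epsilon>))" by (rule less_exp_rate)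
  show "\<forall>\<^sub>F n in sequentially. a < (SUP x. ereal (\<phi> x n powr (1 / real n)))"
    using eventually_gt_at_top[of 0]
  proof eventually_elim
    case (elim n)
    obtain x where "exp ((\<mu> - \<epsilon>) * real n) \<le> \<phi> x n" using lower[OF \<epsilon>(1)] by blast
    then have "ereal (exp (\<mu> - \<epsilon>)) \<le> ereal (\<phi> x n powr (1 / real n))"
      using powr_inverse_ge elim by simp
    also have "\<dots> \<le> (SUP x. ereal (\<phi> x n powr (1 / real n)))" by (rule SUP_upper) simp
    finally show ?case using \<epsilon>(2) by (rule less_le_trans[rotated])
  qed
next
  fix a assume a: "ereal (exp \<mu>) < a"
  show "\<forall>\<^sub>F n in sequentially. (SUP x. ereal (\<phi> x n powr (1 / real n))) < a"
    by (rule eventually_mono[OF eventually_SUP_less[OF a]]) blast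
qed

lemma periodic_limsup_eq: "periodic_limsup f (\<lambda>p k. \<phi> p k powr (1 / real k)) = ereal (exp \<mu>)"
  unfolding periodic_limsup_def
proof (rule antisym)
  let ?F = "inf sequentially (principal {k. \<exists>p. (f ^^ k) p = p})"
  let ?g = "\<lambda>k. SUP p\<in>{p. (f ^^ k) p = p}. ereal (\<phi> p k powr (1 / real k))"
  show "Limsup ?F ?g \<le> ereal (exp \<mu>)"
    unfolding Limsup_le_iff
  proof (intro allI impI)
    fix a assume a: "ereal (exp \<mu>) < a"
    have "\<forall>\<^sub>F k in sequentially. ?g k < a"
      by (rule eventually_mono[OF eventually_SUP_less[OF a]]) blast
    then show "\<forall>\<^sub>F k in ?F. ?g k < a"
      by (auto simp: eventually_inf_principal elim: eventually_mono)
  qed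
  show "ereal (exp \<mu>) \<le> Limsup ?F ?g"
  proof (rule ccontr)
    assume "\<not> ?thesis"
    then have "Limsup ?F ?g < ereal (exp \<mu>)" by simp
    then obtain \<epsilon> where \<epsilon>: "0 < \<epsilon>" "Limsup ?F ?g < ereal (exp (\<mu> - \<epsilon>))" by (rule less_exp_rate)
    obtain k0 where k0: "\<And>k. k0 \<le> k \<Longrightarrow> (\<exists>p. (f ^^ k) p = p) \<Longrightarrow> ?g k < ereal (exp (\<mu> - \<epsilon>))"
      using Limsup_lessD[OF \<epsilon>(2)] unfolding eventually_inf_principal eventually_sequentially by auto
    \<comment> \<open>\<open>max 1\<close> excludes time 0, at which every point is fixed and the
      exponent \<open>1 / real k\<close> is 0.\<close>
    obtain k p where k: "max 1 k0 \<le> k" "(f ^^ k) p = p" "exp ((\<mu> - \<epsilon>) * real k) \<le> \<phi> p k"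
      using periodic[OF \<epsilon>(1)] by blast
    have "ereal (exp (\<mu> - \<epsilon>)) \<le> ereal (\<phi> p k powr (1 / real k))"
      using powr_inverse_ge k by simp
    also have "\<dots> \<le> ?g k" using k(2) by (intro SUP_upper) simp
    also have "\<dots> < ereal (exp (\<mu> - \<epsilon>))" using k by (intro k0) auto
    finally show False by simp
  qed
qed

lemma rate_le_periodic:
  assumes "\<And>p k. 1 \<le> k \<Longrightarrow> (f ^^ k) p = p \<Longrightarrow> \<phi> p k \<le> C * exp (s * real k)"
  shows "\<mu> \<le> s"
proof (rule ccontr)
  assume "\<not> \<mu> \<le> s"
  \<comment> \<open>Half of the gap: periodic lower bound and assumed upper bound then differ by the
    unbounded factor \<open>exp (\<epsilon> * k)\<close>.\<close>
  define \<epsilon> where "\<epsilon> = (\<mu> - s) / 2"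
  have \<epsilon>: "0 < \<epsilon>" "\<mu> - \<epsilon> = s + \<epsilon>" using \<open>\<not> \<mu> \<le> s\<close> by (auto simp: \<epsilon>_def field_simps)
  have "\<exists>k\<ge>k0. exp (\<epsilon> * real k) \<le> C" for k0
  proof -
    obtain k p where k: "max 1 k0 \<le> k" "(f ^^ k) p = p" "exp ((\<mu> - \<epsilon>) * real k) \<le> \<phi> p k"
      using periodic[OF \<epsilon>(1)] by blast
    have "exp (s * real k) * exp (\<epsilon> * real k) = exp ((\<mu> - \<epsilon>) * real k)"
      unfolding \<epsilon>(2) by (simp add: exp_add distrib_right)
    also have "\<dots> \<le> exp (s * real k) * C"
      using k assms[of k p] by (simp add: mult.commute)
    finally show ?thesis using k(1) by auto
  qed
  then show False by (rule exp_unbounded[OF \<epsilon>(1)])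
qed

lemma bound_from_periodic:
  assumes "\<And>p k. 1 \<le> k \<Longrightarrow> (f ^^ k) p = p \<Longrightarrow> \<phi> p k \<le> C * exp (s * real k)" "0 < \<epsilon>"
  shows "\<exists>C'. \<forall>x n. \<phi> x n \<le> C' * exp ((s + \<epsilon>) * real n)"
proof -
  have "0 < s + \<epsilon> - \<mu>" using rate_le_periodic[OF assms(1)] assms(2) by simp
  then show ?thesis using upper[of "s + \<epsilon> - \<mu>"] by simp
qed

end

section \<open>Norming functionals\<close>

definition sublinear :: "('v::real_vector \<Rightarrow> real) \<Rightarrow> bool" where
  "sublinear p \<longleftrightarrow> (\<forall>x y. p (x + y) \<le> p x + p y) \<and> (\<forall>c x. 0 \<le> c \<longrightarrow> p (c *\<^sub>R x) = c * p x)"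

lemma sublinear_zero: "sublinear p \<Longrightarrow> p 0 = 0"
  unfolding sublinear_def by (metis mult_zero_left order_refl scaleR_zero_left)

lemma sublinear_minus: "sublinear p \<Longrightarrow> - p (- x) \<le> p x"
  using sublinear_zero[of p] unfolding sublinear_def by (smt (verit) add.right_inverse)

text \<open>For the infimum over \<open>t \<ge> 0\<close> of
  \<open>p (x + t *\<^sub>R a) - t * p a\<close>, the values \<open>t = 0\<close> and
  \<open>t = 1\<close> give the two bounds, and \<open>- p (- x)\<close> bounds all terms below. It
  makes minimal sublinear functionals additive and lets a functional attain a prescribed
  norm.\<close>

lemma sublinear_shift:
  fixes a :: "'v::real_vector"
  assumes p: "sublinear p"
  obtains r where "sublinear r" "\<And>x. r x \<le> p x" "\<And>x. r x \<le> p (x + a) - p a"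
proof -
  define r where "r x = (INF t\<in>{0..}. p (x + t *\<^sub>R a) - t * p a)" for x
  have add: "p (x + y) \<le> p x + p y" and scale: "0 \<le> c \<Longrightarrow> p (c *\<^sub>R x) = c * p x" for x y c
    using p by (auto simp: sublinear_def)
  have bdd: "bdd_below ((\<lambda>t. p (x + t *\<^sub>R a) - t * p a) ` {0..})" for x
  proof (rule bdd_belowI2)
    fix t :: real assume "t \<in> {0..}"
    then show "- p (- x) \<le> p (x + t *\<^sub>R a) - t * p a"
      using add[of "x + t *\<^sub>R a" "- x"] scale[of t a] by simp
  qed
  have r_le: "r x \<le> p (x + t *\<^sub>R a) - t * p a" if "0 \<le> t" for x t
    unfolding r_def using that by (intro cINF_lower[OF bdd]) auto
  have r_ge: "z \<le> r x" if "\<And>t. 0 \<le> t \<Longrightarrow> z \<le> p (x + t *\<^sub>R a) - t * p a" for x z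
    unfolding r_def using that by (intro cINF_greatest) auto
  have r1: "r x \<le> p x" "r x \<le> p (x + a) - p a" for x
    using r_le[of 0 x] r_le[of 1 x] by simp_all
  have r_add: "r (x + y) \<le> r x + r y" for x y
  proof -
    have "r (x + y) - (p (y + t *\<^sub>R a) - t * p a) \<le> r x" if t: "0 \<le> t" for t
    proof (rule r_ge)
      fix u :: real assume u: "0 \<le> u"
      have "r (x + y) \<le> p ((x + y) + (t + u) *\<^sub>R a) - (t + u) * p a" using t u by (intro r_le) auto
      moreover have "(x + y) + (t + u) *\<^sub>R a = (x + u *\<^sub>R a) + (y + t *\<^sub>R a)"
        by (simp add: scaleR_left_distrib)
      ultimately show "r (x + y) - (p (y + t *\<^sub>R a) - t * p a) \<le> p (x + u *\<^sub>R a) - u * p a"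
        using add[of "x + u *\<^sub>R a" "y + t *\<^sub>R a"] by (simp add: distrib_right)
    qed
    then have "r (x + y) - r x \<le> r y" by (intro r_ge) (simp add: algebra_simps)
    then show ?thesis by simp
  qed
  have r_scale_le: "r (c *\<^sub>R x) \<le> c * r x" if c: "0 < c" for c x
  proof -
    have "r (c *\<^sub>R x) / c \<le> r x"
    proof (rule r_ge)
      fix t :: real assume t: "0 \<le> t"
      have "r (c *\<^sub>R x) \<le> p (c *\<^sub>R x + (c * t) *\<^sub>R a) - (c * t) * p a" using c t by (intro r_le) auto
      also have "c *\<^sub>R x + (c * t) *\<^sub>R a = c *\<^sub>R (x + t *\<^sub>R a)" by (simp add: scaleR_right_distrib)
      also have "p (c *\<^sub>R (x + t *\<^sub>R a)) = c * p (x + t *\<^sub>R a)" using c by (intro scale) auto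
      finally show "r (c *\<^sub>R x) / c \<le> p (x + t *\<^sub>R a) - t * p a" using c by (simp add: field_simps)
    qed
    then show ?thesis using c by (simp add: field_simps)
  qed
  have "r 0 = 0"
  proof (rule antisym)
    show "r 0 \<le> 0" using r_le[of 0 0] sublinear_zero[OF p] by simp
    show "0 \<le> r 0" by (rule r_ge) (simp add: scale)
  qed
  moreover have "r (c *\<^sub>R x) = c * r x" if c: "0 < c" for c x
  proof (rule antisym[OF r_scale_le[OF c]])
    have "r (inverse c *\<^sub>R (c *\<^sub>R x)) \<le> inverse c * r (c *\<^sub>R x)" using c by (intro r_scale_le) auto
    then show "c * r x \<le> r (c *\<^sub>R x)" using c by (simp add: field_simps)
  qed
  ultimately have "sublinear r"
    unfolding sublinear_def using r_add by (metis less_eq_real_def mult_zero_left scaleR_zero_left)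
  then show thesis using that r1 by blast
qed

text \<open>Minimality makes \<open>p\<close> equal to its shift by \<open>a\<close>, and the second
  bound of \<open>sublinear_shift\<close> then reads as superadditivity.\<close>

lemma minimal_sublinear_linear:
  assumes p: "sublinear p" and min: "\<And>r. sublinear r \<Longrightarrow> r \<le> p \<Longrightarrow> r = p"
  shows "linear p"
proof -
  have "p (x + a) = p x + p a" for x a
  proof (rule antisym)
    show "p (x + a) \<le> p x + p a" using p by (simp add: sublinear_def)
    obtain r where r: "sublinear r" "\<And>x. r x \<le> p x" "\<And>x. r x \<le> p (x + a) - p a"
      using sublinear_shift[OF p] by metis
    have "r = p" by (rule min[OF r(1)]) (simp add: le_fun_def r(2))
    then show "p x + p a \<le> p (x + a)" using r(3)[of x] by simp
  qed
  note add = this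
  then have neg: "p (- x) = - p x" for x
    using sublinear_zero[OF p] by (metis add.right_inverse add_eq_0_iff)
  have "p (c *\<^sub>R x) = c * p x" for c x
  proof (cases "0 \<le> c")
    case True
    then show ?thesis using p by (simp add: sublinear_def)
  next
    case False
    then have "0 \<le> - c" by simp
    then have "p ((- c) *\<^sub>R x) = (- c) * p x" using p unfolding sublinear_def by blast
    then show ?thesis using neg[of "c *\<^sub>R x"] by simp
  qed
  then show ?thesis using add by (intro linearI) auto
qed

text \<open>Any two members of a chain have a member below both, which makes the pointwise infimum
  subadditive. The common upper bound \<open>q\<close> keeps it finite, as every member is at least
  \<open>- q (- x)\<close> at \<open>x\<close>.\<close>

lemma sublinear_INF_chain:
  fixes C :: "('v::real_vector \<Rightarrow> real) set"
  assumes C: "\<And>p. p \<in> C \<Longrightarrow> sublinear p" "C \<noteq> {}"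
    and chain: "\<And>p r. p \<in> C \<Longrightarrow> r \<in> C \<Longrightarrow> p \<le> r \<or> r \<le> p"
    and le: "\<And>p. p \<in> C \<Longrightarrow> p \<le> q"
  defines "m \<equiv> \<lambda>x. INF p\<in>C. p x"
  shows "sublinear m" "\<And>p. p \<in> C \<Longrightarrow> m \<le> p"
proof -
  have bdd: "bdd_below ((\<lambda>p. p x) ` C)" for x
  proof (rule bdd_belowI2)
    fix p assume "p \<in> C"
    then show "- q (- x) \<le> p x" using sublinear_minus[OF C(1), of p x] le[of p]
      by (simp add: le_fun_def) (smt (verit))
  qed
  have m_le: "m x \<le> p x" if "p \<in> C" for x p unfolding m_def using that by (intro cINF_lower[OF bdd])
  then show "m \<le> p" if "p \<in> C" for p using that by (simp add: le_fun_def)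
  have m_ge: "z \<le> m x" if "\<And>p. p \<in> C \<Longrightarrow> z \<le> p x" for x z
    unfolding m_def using that C(2) by (intro cINF_greatest) auto
  have "m (x + y) \<le> m x + m y" for x y
  proof -
    have "m (x + y) \<le> p x + r y" if pr: "p \<in> C" "r \<in> C" for p r
    proof -
      obtain s where s: "s \<in> C" "s \<le> p" "s \<le> r" using chain[OF pr] pr by auto
      have "m (x + y) \<le> s x + s y"
        using m_le[OF s(1), of "x + y"] C(1)[OF s(1)] unfolding sublinear_def by (meson order_trans)
      also have "\<dots> \<le> p x + r y" using s by (intro add_mono) (auto simp: le_fun_def)
      finally show ?thesis .
    qed
    then have "m (x + y) - r y \<le> m x" if "r \<in> C" for r using that by (intro m_ge) (simp add: algebra_simps)
    then have "m (x + y) - m x \<le> m y" by (intro m_ge) (simp add: algebra_simps)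
    then show ?thesis by simp
  qed
  moreover have "m (c *\<^sub>R x) = c * m x" if c: "0 \<le> c" for c x
  proof (cases "c = 0")
    case True
    have "m 0 = (INF p\<in>C. 0)"
      unfolding m_def by (rule INF_cong) (auto simp: C(1) sublinear_zero)
    then show ?thesis using True C(2) by simp
  next
    case False
    then have c: "0 < c" using \<open>0 \<le> c\<close> by simp
    have eq: "p (c *\<^sub>R x) = c * p x" if "p \<in> C" for p using C(1)[OF that] c by (simp add: sublinear_def)
    show ?thesis
    proof (rule antisym)
      have "m (c *\<^sub>R x) / c \<le> m x"
      proof (rule m_ge)
        fix p assume p: "p \<in> C"
        show "m (c *\<^sub>R x) / c \<le> p x" using m_le[OF p, of "c *\<^sub>R x"] eq[OF p] c by (simp add: field_simps)
      qed
      then show "m (c *\<^sub>R x) \<le> c * m x" using c by (simp add: field_simps)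
      show "c * m x \<le> m (c *\<^sub>R x)"
      proof (rule m_ge)
        fix p assume p: "p \<in> C"
        show "c * m x \<le> p (c *\<^sub>R x)" using mult_left_mono[OF m_le[OF p, of x], of c] eq[OF p] c by simp
      qed
    qed
  qed
  ultimately show "sublinear m" by (auto simp: sublinear_def)
qed

text \<open>Hahn--Banach: a minimal sublinear functional is linear.\<close>

lemma linear_below_sublinear:
  assumes q: "sublinear q"
  obtains g where "linear g" "\<And>x. g x \<le> q x"
proof -
  define S where "S = {p. sublinear p \<and> p \<le> q}"
  have "\<exists>m\<in>S. \<forall>a\<in>S. a \<le> m \<longrightarrow> a = m"
  \<comment> \<open>Zorn's lemma for the reversed order: chains need lower bounds and the outcome is
    minimal.\<close>
  proof (rule predicate_Zorn[where P = "\<lambda>x y. y \<le> x", simplified])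
    show "partial_order_on S (relation_of (\<lambda>x y. y \<le> x) S)"
      by (rule partial_order_on_relation_ofI) auto
    fix C assume C: "C \<in> Chains (relation_of (\<lambda>x y. y \<le> x) S)"
    then have sub: "C \<subseteq> S" by (simp add: Chains_relation_of)
    show "\<exists>u\<in>S. \<forall>a\<in>C. u \<le> a"
    proof (cases "C = {}")
      case True
      then show ?thesis using q by (auto simp: S_def)
    next
      case False
      have chain: "p \<le> r \<or> r \<le> p" if "p \<in> C" "r \<in> C" for p r
        using C that by (auto simp: Chains_def relation_of_def)
      note m = sublinear_INF_chain[of C q, OF _ False chain]
      have "sublinear (\<lambda>x. INF p\<in>C. p x)" "\<And>p. p \<in> C \<Longrightarrow> (\<lambda>x. INF p\<in>C. p x) \<le> p"
        by (rule m; use sub in \<open>auto simp: S_def\<close>)+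
      then show ?thesis using False sub
        by (intro bexI[of _ "\<lambda>x. INF p\<in>C. p x"]) (auto simp: S_def intro: order_trans)
    qed
  qed
  then obtain m where m: "sublinear m" "m \<le> q" "\<And>a. sublinear a \<Longrightarrow> a \<le> q \<Longrightarrow> a \<le> m \<Longrightarrow> a = m"
    by (auto simp: S_def)
  have "linear m" by (rule minimal_sublinear_linear[OF m(1)]) (use m in \<open>auto intro: order_trans\<close>)
  then show thesis using that m(2) by (auto simp: le_fun_def)
qed

text \<open>Shifting the norm by \<open>v\<close> gives a sublinear \<open>r\<close> with
  \<open>r (- v) \<le> - norm v\<close>; a linear functional below \<open>r\<close> is bounded by
  the norm and has value at least \<open>norm v\<close> at \<open>v\<close>.\<close>

lemma norming_functional:
  fixes v :: "'v::real_normed_vector"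
  obtains \<psi> :: "'v \<Rightarrow>\<^sub>L real" where "norm \<psi> \<le> 1" "blinfun_apply \<psi> v = norm v"
proof -
  have n: "sublinear (norm :: 'v \<Rightarrow> real)" by (auto simp: sublinear_def norm_triangle_ineq)
  obtain r where r: "sublinear r" "\<And>x. r x \<le> norm x" "\<And>x. r x \<le> norm (x + v) - norm v"
    using sublinear_shift[OF n, of v] by metis
  obtain g where g: "linear g" "\<And>x. g x \<le> r x"
    using linear_below_sublinear[OF r(1)] by metis
  have le: "g x \<le> norm x" for x using g(2)[of x] r(2)[of x] by simp
  have abs: "\<bar>g x\<bar> \<le> norm x" for x
    using le[of x] le[of "- x"] linear_neg[OF g(1), of x] by simp
  have "g (- v) \<le> - norm v" using g(2)[of "- v"] r(3)[of "- v"] by simp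
  then have gv: "g v = norm v" using linear_neg[OF g(1), of v] le[of v] by simp
  have bl: "bounded_linear g"
    using g(1) abs by (intro bounded_linear_intro[where K = 1])
      (auto simp: linear_add linear_scale)
  show thesis
  proof
    show "norm (Blinfun g) \<le> 1"
      by (rule norm_blinfun_bound) (use abs in \<open>auto simp: bounded_linear_Blinfun_apply[OF bl]\<close>)
    show "blinfun_apply (Blinfun g) v = norm v" by (simp add: bounded_linear_Blinfun_apply[OF bl] gv)
  qed
qed

section \<open>Conjugation cocycles\<close>

text \<open>\<open>S\<close> and \<open>T\<close> are independent so that a difference of
  conjugations splits, in \<open>sandwich_diff\<close>, into operators of the same form. Conjugation
  is the case where \<open>T\<close> is the inverse of \<open>S\<close>.\<close>

definition sandwich :: "('v::real_normed_vector \<Rightarrow>\<^sub>L 'v) \<Rightarrow> ('v \<Rightarrow>\<^sub>L 'v) \<Rightarrow> (('v \<Rightarrow>\<^sub>L 'v) \<Rightarrow>\<^sub>L ('v \<Rightarrow>\<^sub>L 'v))" where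
  "sandwich S T = Blinfun (\<lambda>X. S o\<^sub>L X o\<^sub>L T)"

lemma sandwich_apply [simp]: "blinfun_apply (sandwich S T) X = S o\<^sub>L X o\<^sub>L T"
proof -
  have "bounded_linear (\<lambda>X. S o\<^sub>L X o\<^sub>L T)"
    by (intro bounded_linear_intros)
  then show ?thesis by (simp add: sandwich_def bounded_linear_Blinfun_apply)
qed

lemma sandwich_id [simp]: "sandwich id_blinfun id_blinfun = id_blinfun"
  by (rule blinfun_eqI) simp

lemma sandwich_compose: "sandwich S T o\<^sub>L sandwich S' T' = sandwich (S o\<^sub>L S') (T' o\<^sub>L T)"
  by (rule blinfun_eqI) (simp add: blinfun_compose_assoc)

lemma sandwich_diff: "sandwich S T - sandwich S' T' = sandwich (S - S') T + sandwich S' (T - T')"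
  by (rule blinfun_eqI)
    (simp add: blinfun.bilinear_simps blinfun_compose.diff_left blinfun_compose.diff_right)

text \<open>The lower bound is tested on rank-one operators \<open>X\<close> with range spanned by
  \<open>w\<close>, built from a functional norming \<open>T u\<close>: the image of
  \<open>X\<close> under the sandwich sends \<open>u\<close> to \<open>norm (T u)\<close> times
  \<open>S w\<close>.\<close>

lemma norm_sandwich: "norm (sandwich S T) = norm S * norm T"
proof (rule antisym)
  show "norm (sandwich S T) \<le> norm S * norm T"
  proof (rule norm_blinfun_bound)
    fix X
    have "norm (S o\<^sub>L X o\<^sub>L T) \<le> (norm S * norm X) * norm T"
      by (auto intro!: order_trans[OF norm_blinfun_compose] mult_right_mono norm_blinfun_compose)
    then show "norm (blinfun_apply (sandwich S T) X) \<le> norm S * norm T * norm X"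
      by (simp add: mult_ac)
  qed simp
next
  let ?c = "norm (sandwich S T)"
  have rank_one: "norm (blinfun_apply T u) * norm (blinfun_apply S w) \<le> ?c * norm u * norm w" for u w
  proof -
    obtain \<psi> where \<psi>: "norm \<psi> \<le> 1" "blinfun_apply \<psi> (blinfun_apply T u) = norm (blinfun_apply T u)"
      by (rule norming_functional)
    define X where "X = blinfun_scaleR_left w o\<^sub>L \<psi>"
    have "norm X \<le> norm w"
    proof (rule norm_blinfun_bound)
      fix z
      have "norm (blinfun_apply \<psi> z) \<le> 1 * norm z"
        using norm_blinfun[of \<psi> z] \<psi>(1) by (meson mult_right_mono norm_ge_zero order_trans)
      then show "norm (blinfun_apply X z) \<le> norm w * norm z"
        by (simp add: X_def mult.commute mult_left_mono)
    qed simp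
    have "norm (blinfun_apply T u) * norm (blinfun_apply S w) =
        norm (blinfun_apply (blinfun_apply (sandwich S T) X) u)"
      by (simp add: X_def \<psi>(2) blinfun.bilinear_simps)
    also have "\<dots> \<le> norm (blinfun_apply (sandwich S T) X) * norm u" by (rule norm_blinfun)
    also have "\<dots> \<le> (?c * norm X) * norm u" by (intro mult_right_mono norm_blinfun) auto
    also have "\<dots> \<le> (?c * norm w) * norm u"
      using \<open>norm X \<le> norm w\<close> by (intro mult_right_mono mult_left_mono) auto
    finally show ?thesis by (simp add: mult_ac)
  qed
  \<comment> \<open>The suprema over \<open>w\<close> and then over \<open>u\<close> are taken as
    operator norms of scalar multiples of \<open>S\<close> and of \<open>T\<close>.\<close>
  have "norm (norm (blinfun_apply T u) *\<^sub>R S) \<le> ?c * norm u" for u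
    by (rule norm_blinfun_bound) (use rank_one[of u] in \<open>auto simp: blinfun.bilinear_simps\<close>)
  then have "norm (norm S *\<^sub>R T) \<le> ?c"
    by (intro norm_blinfun_bound) (auto simp: blinfun.bilinear_simps mult.commute)
  then show "norm S * norm T \<le> ?c" by simp
qed

lemma
  assumes "S \<in> GL" "T \<in> GL"
  shows sandwich_GL: "sandwich S T \<in> GL"
    and GL_inv_sandwich: "GL_inv (sandwich S T) = sandwich (GL_inv S) (GL_inv T)"
proof -
  have *: "sandwich S T o\<^sub>L sandwich (GL_inv S) (GL_inv T) = id_blinfun"
    "sandwich (GL_inv S) (GL_inv T) o\<^sub>L sandwich S T = id_blinfun"
    using assms by (simp_all add: sandwich_compose GL_inv_left GL_inv_right)
  show "sandwich S T \<in> GL" using * unfolding GL_def by blast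
  show "GL_inv (sandwich S T) = sandwich (GL_inv S) (GL_inv T)" by (rule GL_inv_eq[OF *])
qed

abbreviation conj_generator :: "('a \<Rightarrow> ('v::real_normed_vector \<Rightarrow>\<^sub>L 'v)) \<Rightarrow> 'a \<Rightarrow> _" where
  "conj_generator A x \<equiv> sandwich (A x) (GL_inv (A x))"

text \<open>Composition of sandwiches reverses the second factors just as inversion does. With
  \<open>norm_sandwich\<close>, the norm of this cocycle is the distortion.\<close>

lemma cocycle_nat_conj:
  assumes "\<forall>x. A x \<in> GL"
  shows "cocycle_nat f (conj_generator A) x n =
    sandwich (cocycle_nat f A x n) (GL_inv (cocycle_nat f A x n))"
  by (induction n)
    (simp_all add: assms GL_inv_id sandwich_compose GL_inv_compose cocycle_nat_GL)

text \<open>Both factors of a conjugation are bounded by \<open>K\<close>, so the product rule costs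
  a factor \<open>K\<close>; another factor 2 arises because \<open>GL_dist\<close> also compares
  the inverse conjugations. The exponent is unchanged.\<close>

lemma holder_GL_conj:
  fixes A :: "'a::metric_space \<Rightarrow> ('v::real_normed_vector \<Rightarrow>\<^sub>L 'v)"
  assumes "compact (UNIV :: 'a set)" "\<forall>x. A x \<in> GL" "holder_GL A"
  shows "holder_GL (conj_generator A)"
proof -
  obtain K where K: "1 \<le> K" "\<And>x. norm (A x) \<le> K" "\<And>x. norm (GL_inv (A x)) \<le> K"
    using holder_GL_bounded[OF assms(1,3)] by metis
  obtain \<alpha> M \<delta> where h: "0 < \<alpha>" "\<alpha> \<le> 1" "0 < M" "0 < \<delta>"
    "\<And>x y. dist x y < \<delta> \<Longrightarrow> GL_dist (A x) (A y) \<le> M * dist x y powr \<alpha>"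
    using assms(3) unfolding holder_GL_def by metis
  have le: "norm (sandwich S T - sandwich S' T') \<le> K * (norm (S - S') + norm (T - T'))"
    if "norm S' \<le> K" "norm T \<le> K" for S T S' T' :: "'v \<Rightarrow>\<^sub>L 'v"
  proof -
    have "norm (sandwich S T - sandwich S' T') \<le> norm (S - S') * norm T + norm S' * norm (T - T')"
      unfolding sandwich_diff norm_sandwich[symmetric] by (rule norm_triangle_ineq)
    also have "\<dots> \<le> norm (S - S') * K + K * norm (T - T')"
      using that K(1) by (intro add_mono mult_mono) auto
    finally show ?thesis by (simp add: algebra_simps)
  qed
  have "GL_dist (conj_generator A x) (conj_generator A y) \<le> 2 * K * GL_dist (A x) (A y)" for x y
    using le[OF K(2)[of y] K(3)[of x], of "A x" "GL_inv (A y)"]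
      le[OF K(3)[of y] K(2)[of x], of "GL_inv (A x)" "A y"] assms(2)
    by (simp add: GL_dist_def GL_inv_sandwich GL_GL_inv GL_inv_GL_inv algebra_simps)
  moreover have "2 * K * GL_dist (A x) (A y) \<le> (2 * K * M) * dist x y powr \<alpha>" if "dist x y < \<delta>" for x y
    using mult_left_mono[OF h(5)[OF that], of "2 * K"] K(1) by (simp add: mult.assoc)
  ultimately have "\<forall>x y. dist x y < \<delta> \<longrightarrow>
      GL_dist (conj_generator A x) (conj_generator A y) \<le> (2 * K * M) * dist x y powr \<alpha>"
    by (meson order_trans)
  moreover have "0 < 2 * K * M" using h K(1) by simp
  ultimately show ?thesis
    unfolding holder_GL_def using h by blast
qed

text \<open>Obtained from \<open>periodic_growth\<close> for the constant identity cocycle on the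
  reals; it serves the case of a zero Banach space.\<close>

lemma infinitely_many_periods:
  fixes f :: "'a::metric_space \<Rightarrow> 'a"
  assumes "compact (UNIV :: 'a set)" "closing_property f"
  shows "\<exists>k\<ge>k0. \<exists>p. (f ^^ k) p = p"
proof -
  have "holder_GL (\<lambda>_::'a. id_blinfun :: real \<Rightarrow>\<^sub>L real)"
    unfolding holder_GL_def GL_dist_def by (intro exI[of _ 1]) auto
  then show ?thesis
    using periodic_growth[OF assms, of "\<lambda>_. id_blinfun :: real \<Rightarrow>\<^sub>L real" 1] GL_id zero_less_one
    by (metis zero_neq_one)
qed

text \<open>Arbitrarily large periods make the filter proper, and along a proper filter a constant
  is its own upper limit.\<close>

lemma periodic_limsup_const:
  assumes "\<And>k0. \<exists>k\<ge>k0. \<exists>p. (f ^^ k) p = p"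
  shows "periodic_limsup f (\<lambda>p k. c) = ereal c"
proof -
  let ?F = "inf sequentially (principal {k. \<exists>p. (f ^^ k) p = p})"
  have ntriv: "?F \<noteq> bot"
    unfolding trivial_limit_def eventually_inf_principal eventually_sequentially using assms by auto
  have const: "\<forall>\<^sub>F k in ?F. (SUP p\<in>{p. (f ^^ k) p = p}. ereal c) = ereal c"
    unfolding eventually_inf_principal by (auto intro!: always_eventually SUP_const)
  show ?thesis
    unfolding periodic_limsup_def Limsup_eq[OF const] by (rule Limsup_const[OF ntriv])
qed

lemma cocycle_growth_rate:
  fixes f :: "'a::metric_space \<Rightarrow> 'a" and A :: "'a \<Rightarrow> ('v::real_normed_vector \<Rightarrow>\<^sub>L 'v)"
  defines "W \<equiv> cocycle_nat f A"
  assumes cpt: "compact (UNIV :: 'a set)" and closing: "closing_property f"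
    and GL: "\<forall>x. A x \<in> GL" and holder: "holder_GL A"
  shows "(\<lambda>n. SUP x. ereal (norm (W x n) powr (1 / real n))) \<longlonglongrightarrow>
      periodic_limsup f (\<lambda>p k. norm (W p k) powr (1 / real k))"
    and "\<And>C s \<epsilon>. (\<And>p k. 1 \<le> k \<Longrightarrow> (f ^^ k) p = p \<Longrightarrow> norm (W p k) \<le> C * exp (s * real k)) \<Longrightarrow> 0 < \<epsilon> \<Longrightarrow>
      \<exists>C'. \<forall>x n. norm (W x n) \<le> C' * exp ((s + \<epsilon>) * real n)"
proof (atomize (full), cases "\<exists>v::'v. v \<noteq> 0")
  case True
  then obtain v :: 'v where v: "v \<noteq> 0" by blast
  obtain \<mu> where \<mu>: "exponential_growth f (\<lambda>x n. norm (W x n)) \<mu>"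
    using periodic_growth[OF cpt closing GL holder v, folded W_def]
    unfolding exponential_growth_def by (metis norm_ge_zero)
  interpret exponential_growth f "\<lambda>x n. norm (W x n)" \<mu> by (rule \<mu>)
  show "(\<lambda>n. SUP x. ereal (norm (W x n) powr (1 / real n))) \<longlonglongrightarrow>
      periodic_limsup f (\<lambda>p k. norm (W p k) powr (1 / real k)) \<and>
    (\<forall>C s \<epsilon>. (\<forall>p k. 1 \<le> k \<longrightarrow> (f ^^ k) p = p \<longrightarrow> norm (W p k) \<le> C * exp (s * real k)) \<longrightarrow> 0 < \<epsilon> \<longrightarrow>
      (\<exists>C'. \<forall>x n. norm (W x n) \<le> C' * exp ((s + \<epsilon>) * real n)))"
    using tendsto_SUP bound_from_periodic unfolding periodic_limsup_eq by blast
next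
  case False
  \<comment> \<open>On the zero space all norms vanish and \<open>0 powr y = 0\<close>, so both
    sides of the limit are 0.\<close>
  then have "norm (W x n) = 0" for x n
    by (metis blinfun_eqI norm_zero)
  then show "(\<lambda>n. SUP x. ereal (norm (W x n) powr (1 / real n))) \<longlonglongrightarrow>
      periodic_limsup f (\<lambda>p k. norm (W p k) powr (1 / real k)) \<and>
    (\<forall>C s \<epsilon>. (\<forall>p k. 1 \<le> k \<longrightarrow> (f ^^ k) p = p \<longrightarrow> norm (W p k) \<le> C * exp (s * real k)) \<longrightarrow> 0 < \<epsilon> \<longrightarrow>
      (\<exists>C'. \<forall>x n. norm (W x n) \<le> C' * exp ((s + \<epsilon>) * real n)))"
    using periodic_limsup_const[of f 0, OF infinitely_many_periods[OF cpt closing]]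
    by (auto intro!: exI[of _ 0])
qed

section \<open>Distortion at positive and negative times\<close>

lemma cocycle_Q_eq:
  fixes A :: "'a::metric_space \<Rightarrow> ('v::real_normed_vector \<Rightarrow>\<^sub>L 'v)"
  assumes "\<forall>x. A x \<in> GL"
  shows "cocycle_Q f A x (int n) = norm (cocycle_nat f (conj_generator A) x n)"
    and "cocycle_Q f A x (- int n) = norm (cocycle_nat f (conj_generator A) ((inv f ^^ n) x) n)"
proof -
  show nonneg: "cocycle_Q f A x (int n) = norm (cocycle_nat f (conj_generator A) x n)" for n
    using assms(1) by (simp add: cocycle_Q_def cocycle_def cocycle_nat_conj norm_sandwich)
  show "cocycle_Q f A x (- int n) = norm (cocycle_nat f (conj_generator A) ((inv f ^^ n) x) n)"
  \<comment> \<open>Time 0 falls under the non-negative branch of \<open>cocycle\<close>. Otherwise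
    the cocycle is the inverse of a forward one started at \<open>(inv f ^^ n) x\<close>, and the
    distortion is symmetric under inversion.\<close>
  proof (cases "n = 0")
    case True
    then show ?thesis using nonneg[of 0] by simp
  next
    case False
    then show ?thesis using assms(1)
      by (simp add: cocycle_Q_def cocycle_def cocycle_nat_conj norm_sandwich
        GL_inv_GL_inv cocycle_nat_GL mult.commute)
  qed
qed

theorem corollary1p6:
  fixes f :: "'a::metric_space \<Rightarrow> 'a"
    and A :: "'a \<Rightarrow> ('v::banach \<Rightarrow>\<^sub>L 'v)"
  assumes "compact (UNIV :: 'a set)"
    and "homeomorphism UNIV UNIV f (inv f)"
    and "closing_property f"
    and "\<forall>x. A x \<in> GL"
    and "holder_GL A"
  shows
    "((\<lambda>n::nat. SUP x. ereal (norm (cocycle f A x (int n)) powr (1 / real n))) \<longlongrightarrow>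
        periodic_limsup f (\<lambda>p k. norm (cocycle f A p (int k)) powr (1 / real k))) at_top
     \<and> (\<forall>C s :: real.
          (\<forall>p. \<forall>k\<ge>1. (f ^^ k) p = p \<longrightarrow> norm (cocycle f A p (int k)) \<le> C * exp (s * real k)) \<longrightarrow>
          (\<forall>\<epsilon>>0. \<exists>C\<^sub>\<epsilon>. \<forall>x. \<forall>n\<ge>1.
              norm (cocycle f A x (int n)) \<le> C\<^sub>\<epsilon> * exp ((s + \<epsilon>) * real n)))
     \<and> ((\<lambda>n::int. SUP x. ereal (cocycle_Q f A x n powr (1 / real_of_int \<bar>n\<bar>))) \<longlongrightarrow>
        periodic_limsup f (\<lambda>p k. cocycle_Q f A p (int k) powr (1 / real k))) at_top
     \<and> ((\<lambda>n::int. SUP x. ereal (cocycle_Q f A x n powr (1 / real_of_int \<bar>n\<bar>))) \<longlongrightarrow>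
        periodic_limsup f (\<lambda>p k. cocycle_Q f A p (int k) powr (1 / real k))) at_bot
     \<and> (\<forall>C s :: real.
          (\<forall>p. \<forall>k\<ge>1. (f ^^ k) p = p \<longrightarrow> cocycle_Q f A p (int k) \<le> C * exp (s * real k)) \<longrightarrow>
          (\<forall>\<epsilon>>0. \<exists>C\<^sub>\<epsilon>. \<forall>x. \<forall>n::int.
              cocycle_Q f A x n \<le> C\<^sub>\<epsilon> * exp ((s + \<epsilon>) * real_of_int \<bar>n\<bar>)))"
proof -
  note cpt = assms(1) and closing = assms(3) and GL = assms(4) and holder = assms(5)
  define W where "W = cocycle_nat f A"
  define V where "V = cocycle_nat f (conj_generator A)"
  have W: "cocycle f A x (int n) = W x n" for x n by (simp add: cocycle_def W_def)
  have V: "cocycle_Q f A x (int n) = norm (V x n)"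
    and V_neg: "cocycle_Q f A x (- int n) = norm (V ((inv f ^^ n) x) n)" for x n
    using cocycle_Q_eq[OF GL, of f] by (simp_all add: V_def)
  have conj: "\<forall>x. conj_generator A x \<in> GL"
    using GL by (simp add: sandwich_GL GL_GL_inv)
  note gW = cocycle_growth_rate[OF cpt closing GL holder, folded W_def]
  note gV = cocycle_growth_rate[OF cpt closing conj holder_GL_conj[OF cpt GL holder], folded V_def]
  let ?V = "\<lambda>n. SUP x. ereal (norm (V x n) powr (1 / real n))"
  let ?Q = "\<lambda>n::int. SUP x. ereal (cocycle_Q f A x n powr (1 / real_of_int \<bar>n\<bar>))"
  have Q_pos: "?Q (int n) = ?V n" for n by (simp add: V)
  have Q_neg: "?Q (- int n) = ?V n" for n
  proof -
    \<comment> \<open>\<open>inv f ^^ n\<close> is onto, so the change of base point at negative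
      times leaves the supremum unchanged.\<close>
    have "inj f" using assms(2) by (metis UNIV_I homeomorphism_apply1 injI)
    then have "range (inv f ^^ n) = UNIV" by (simp add: inj_imp_surj_inv surj_fn)
    then have "?V n = (SUP x\<in>range (inv f ^^ n). ereal (norm (V x n) powr (1 / real n)))" by simp
    also have "\<dots> = ?Q (- int n)" by (simp add: V_neg image_image)
    finally show ?thesis by simp
  qed
  have nat_at_bot: "filterlim (\<lambda>n. nat (- n)) sequentially at_bot"
    unfolding at_bot_mirror filterlim_filtermap using filterlim_nat_sequentially by simp
  have "((\<lambda>n. ?V (nat n)) \<longlongrightarrow> periodic_limsup f (\<lambda>p k. norm (V p k) powr (1 / real k))) at_top"
    by (rule filterlim_compose[OF gV(1) filterlim_nat_sequentially])
  moreover have "\<forall>\<^sub>F n in at_top. ?V (nat n) = ?Q n"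
    using eventually_ge_at_top[of 0]
  proof eventually_elim
    case (elim n)
    then show ?case using Q_pos[of "nat n"] by simp
  qed
  ultimately have top: "(?Q \<longlongrightarrow> periodic_limsup f (\<lambda>p k. norm (V p k) powr (1 / real k))) at_top"
    by (rule Lim_transform_eventually)
  have "((\<lambda>n. ?V (nat (- n))) \<longlongrightarrow> periodic_limsup f (\<lambda>p k. norm (V p k) powr (1 / real k))) at_bot"
    by (rule filterlim_compose[OF gV(1) nat_at_bot])
  moreover have "\<forall>\<^sub>F n in at_bot. ?V (nat (- n)) = ?Q n"
    using eventually_le_at_bot[of 0]
  proof eventually_elim
    case (elim n)
    then show ?case using Q_neg[of "nat (- n)"] by simp
  qed
  ultimately have bot: "(?Q \<longlongrightarrow> periodic_limsup f (\<lambda>p k. norm (V p k) powr (1 / real k))) at_bot"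
    by (rule Lim_transform_eventually)
  have boundW: "\<exists>C'. \<forall>x. \<forall>n\<ge>1. norm (W x n) \<le> C' * exp ((s + \<epsilon>) * real n)"
    if "\<forall>p. \<forall>k\<ge>1. (f ^^ k) p = p \<longrightarrow> norm (W p k) \<le> C * exp (s * real k)" "0 < \<epsilon>" for C s \<epsilon>
    using gW(2)[of C s \<epsilon>] that by blast
  have boundQ: "\<exists>C'. \<forall>x n. cocycle_Q f A x n \<le> C' * exp ((s + \<epsilon>) * real_of_int \<bar>n\<bar>)"
    if per: "\<forall>p. \<forall>k\<ge>1. (f ^^ k) p = p \<longrightarrow> norm (V p k) \<le> C * exp (s * real k)" and "0 < \<epsilon>" for C s \<epsilon>
  proof -
    obtain C' where C': "\<And>x n. norm (V x n) \<le> C' * exp ((s + \<epsilon>) * real n)"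
      using gV(2)[of C s \<epsilon>] per \<open>0 < \<epsilon>\<close> by blast
    \<comment> \<open>Uniformity in the point absorbs the shifted base point at negative times, so
      one constant serves both signs.\<close>
    have "cocycle_Q f A x n \<le> C' * exp ((s + \<epsilon>) * real_of_int \<bar>n\<bar>)" for x n
      using C' by (cases n rule: int_cases2) (simp_all add: V V_neg)
    then show ?thesis by blast
  qed
  show ?thesis
    unfolding W V
    by (intro conjI gW(1) top bot; intro allI impI; (rule boundW | rule boundQ); assumption)
qed

end
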